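(* Let $\alpha_1,\ldots,\alpha_n$ be multiindices of length $n$ (elements of $\mathbb{Z}_{\ge0}^n$) which are linearly independent as vectors in $\mathbb{R}^n$ and whose sum is $(\sigma,\ldots,\sigma)$ for some integer $\sigma$. Then the averaging operator on $\mathbb{R}^n\times\mathbb{R}$ given by $$Rf(y_0,\ldots,y_n):=\int_{\mathbb{R}^n}f\big(t,\,y_0+y_1t^{\alpha_1}+\cdots+y_nt^{\alpha_n}\big)\,dt$$ is bounded from $L^{\frac{n+1+\sigma}{n+1}}(\mathbb{R}^n\times\mathbb{R})$ to $L^{n+1+\sigma}(\mathbb{R}^{n+1})$.
   Context: For $t\in\mathbb{R}^n$ and a multiindex $\alpha=(a_1,\ldots,a_n)$, $t^\alpha:=\prod_{i=1}^n t_i^{a_i}$. *)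

theory Defs
  imports "HOL-Analysis.Analysis"
begin

definition multiindex_vec :: "nat ^ 'n \<Rightarrow> real ^ 'n" where
  "multiindex_vec a = (\<chi> i. real (a $ i))"

definition multi_power :: "real ^ 'n \<Rightarrow> nat ^ 'n \<Rightarrow> real" where
  "multi_power t a = (\<Prod>i\<in>UNIV. (t $ i) ^ (a $ i))"

text \<open>For finite exponents \<open>p \<ge> 1\<close>; functions are not identified when they agree almost
  everywhere, so \<open>Lp_norm\<close> is only a seminorm.\<close>

definition Lp_space :: "real \<Rightarrow> 'a measure \<Rightarrow> ('a \<Rightarrow> complex) set" where
  "Lp_space p M = {f \<in> borel_measurable M. integrable M (\<lambda>x. norm (f x) powr p)}"

definition Lp_norm :: "real \<Rightarrow> 'a measure \<Rightarrow> ('a \<Rightarrow> complex) \<Rightarrow> real" where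
  "Lp_norm p M f = (\<integral>x. norm (f x) powr p \<partial>M) powr (1 / p)"

definition Lp_bounded ::
    "real \<Rightarrow> 'a measure \<Rightarrow> real \<Rightarrow> 'b measure \<Rightarrow> (('a \<Rightarrow> complex) \<Rightarrow> 'b \<Rightarrow> complex) \<Rightarrow> bool" where
  "Lp_bounded p M q N T \<longleftrightarrow>
     (\<exists>C. \<forall>f\<in>Lp_space p M. T f \<in> Lp_space q N \<and> Lp_norm q N (T f) \<le> C * Lp_norm p M f)"

text \<open>A point \<open>(y\<^sub>0, \<dots>, y\<^sub>n)\<close> is represented as the pair of \<open>y\<^sub>0\<close> and the vector
  \<open>(y\<^sub>1, \<dots>, y\<^sub>n)\<close>.\<close>

definition averaging_point ::
    "('n \<Rightarrow> nat ^ 'n) \<Rightarrow> real \<times> (real ^ 'n) \<Rightarrow> real ^ 'n \<Rightarrow> (real ^ 'n) \<times> real" where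
  "averaging_point \<alpha> y t = (t, fst y + (\<Sum>j\<in>UNIV. snd y $ j * multi_power t (\<alpha> j)))"

text \<open>The Bochner integral is \<open>0\<close> by convention where the integrand is not integrable, so
  almost everywhere convergence of this integral has to be asserted separately.\<close>

definition averaging_op ::
    "('n \<Rightarrow> nat ^ 'n) \<Rightarrow> ((real ^ 'n) \<times> real \<Rightarrow> complex) \<Rightarrow> real \<times> (real ^ 'n) \<Rightarrow> complex" where
  "averaging_op \<alpha> f y = (\<integral>t. f (averaging_point \<alpha> y t) \<partial>lebesgue)"

end

theory Submission
  imports Defs
begin

text \<open>
  Put \<open>g(t) = |f(t, y\<^sub>0 + \<Sum>\<^sub>k y\<^sub>k t\<^sup>\<alpha>\<^sub>k)|\<close>, \<open>q = n + 1 + \<sigma>\<close> and \<open>p = q / (n + 1)\<close>, and let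
  \<open>D(t\<^sub>0, \<dots>, t\<^sub>n)\<close> be the determinant of the \<open>n \<times> n\<close> matrix of the differences
  \<open>P\<^sub>k(t\<^sub>j) - P\<^sub>k(t\<^sub>0)\<close>, \<open>j, k \<ge> 1\<close>, of the monomials \<open>P\<^sub>k = t\<^sup>\<alpha>\<^sub>k\<close>. For every \<open>y\<close>,
  \<open>(\<integral> g)\<^sup>q \<le> C \<integral> |D| \<Prod>\<^sub>j g(t\<^sub>j)\<^sup>p dt\<^sub>0 \<dots> dt\<^sub>n\<close>.
  Integrated over \<open>y\<close>, the right-hand side is at most \<open>C (\<integral> |f|\<^sup>p)\<close> to the power \<open>n + 1\<close>, since \<open>|D|\<close> is the
  Jacobian of the linear map from \<open>y\<close> to the \<open>n + 1\<close> values of the second argument of \<open>f\<close>.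

  For the pointwise inequality, let \<open>d\<^sub>k\<close> be the infimum, over all combinations \<open>w\<close> of \<open>1\<close> and the \<open>P\<^sub>j\<close>
  with \<open>j < k\<close>, of \<open>\<integral> |P\<^sub>k + w| g\<^sup>p\<close>, and \<open>d\<^sub>0 = \<integral> g\<^sup>p\<close>. Expanding \<open>D\<close> along its last row shows that the
  integral of \<open>|D|\<close> is at least \<open>d\<^sub>0 d\<^sub>1 \<dots> d\<^sub>n\<close>. If \<open>w\<^sub>k\<close> are near-minimisers (\<open>w\<^sub>0 = 1\<close>) and
  \<open>W = \<Sum>\<^sub>k |w\<^sub>k| / d\<^sub>k\<close>, then \<open>\<integral> W g\<^sup>p\<close> is bounded by a constant, and so \<open>\<integral> g\<close> is controlled by the
  integral of \<open>W\<close> to the power \<open>-(n + 1) / \<sigma>\<close>. In the coordinates \<open>x\<^sub>k = P\<^sub>k(t)\<close>, whose Jacobian is a constant times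
  \<open>\<Prod>\<^sub>k |x\<^sub>k|\<close> to the power \<open>1 - 1 / \<sigma>\<close> because the exponents add up to \<open>(\<sigma>, \<dots>, \<sigma>)\<close>, the \<open>w\<^sub>k\<close> are triangular,
  and this integral is estimated one variable at a time by a multiple of \<open>\<Prod>\<^sub>k d\<^sub>k\<close> to the power \<open>1 / \<sigma>\<close>.
\<close>

section \<open>Lebesgue measure on coordinate spaces\<close>

lemma measurable_vec_nth [measurable]: "(\<lambda>x :: (real, 'n::finite) vec. x $ k) \<in> borel_measurable borel"
  by (intro borel_measurable_continuous_onI continuous_intros)

lemma prod_Basis_vec:
  fixes f :: "real ^ 'n::finite \<Rightarrow> 'a::comm_monoid_mult"
  shows "(\<Prod>b\<in>Basis. f b) = (\<Prod>i\<in>UNIV. f (axis i 1))"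
proof -
  have "(Basis :: (real ^ 'n) set) = range (\<lambda>i. axis i 1)"
    by (auto simp: Basis_vec_def)
  moreover have "inj (\<lambda>i::'n. axis i (1::real))"
    by (auto simp: inj_on_def axis_eq_axis)
  ultimately show ?thesis
    by (metis (no_types, lifting) prod.reindex_cong)
qed

lemma measurable_vec_lambda_PiM [measurable]:
  "(\<lambda>x. \<chi> i. x i) \<in> PiM UNIV (\<lambda>_::'n::finite. lborel :: real measure) \<rightarrow>\<^sub>M borel"
proof (subst borel_measurable_iff_halfspace_le, safe)
  fix i :: "real ^ 'n" and a
  assume "i \<in> Basis"
  then obtain k where "i = axis k 1"
    by (auto simp: Basis_vec_def)
  then show "{w \<in> space (PiM UNIV (\<lambda>_::'n. lborel :: real measure)). (\<chi> i. w i) \<bullet> i \<le> a}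
      \<in> sets (PiM UNIV (\<lambda>_::'n. lborel :: real measure))"
    by (simp add: inner_axis) measurable
qed

text \<open>Boxes have the same volume under both measures, and box volumes determine
  \<open>lborel\<close>. This opens integrals over vectors to integration one coordinate at a
  time.\<close>

lemma lborel_vec_eq:
  "lborel = distr (PiM UNIV (\<lambda>_::'n::finite. lborel :: real measure)) borel (\<lambda>x. \<chi> i. x i)"
proof (rule lborel_eqI)
  interpret finite_product_sigma_finite "\<lambda>_::'n. lborel :: real measure" UNIV
    by standard simp
  fix l u :: "real ^ 'n"
  assume le: "\<And>b. b \<in> Basis \<Longrightarrow> l \<bullet> b \<le> u \<bullet> b"
  then have le': "l $ i \<le> u $ i" for i
    using le[of "axis i 1"] by (simp add: inner_axis)
  have *: "(\<lambda>x. \<chi> i. x i) -` box l u \<inter> space (PiM UNIV (\<lambda>_. lborel :: real measure))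
    = PiE UNIV (\<lambda>i. {l $ i<..<u $ i})"
    by (auto simp: mem_box_cart space_PiM PiE_def Pi_def)
  show "emeasure (distr (PiM UNIV (\<lambda>_::'n. lborel :: real measure)) borel (\<lambda>x. \<chi> i. x i)) (box l u)
    = ennreal (\<Prod>b\<in>Basis. (u - l) \<bullet> b)"
    by (subst emeasure_distr)
      (use le' in \<open>auto simp: * measure_times prod_Basis_vec inner_axis prod_ennreal\<close>)
qed simp

lemma nn_integral_vec:
  fixes f :: "real ^ 'n::finite \<Rightarrow> ennreal"
  assumes "f \<in> borel_measurable borel"
  shows "(\<integral>\<^sup>+x. f x \<partial>lborel) = (\<integral>\<^sup>+x. f (\<chi> i. x i) \<partial>PiM UNIV (\<lambda>_. lborel))"
  by (subst lborel_vec_eq) (use assms in \<open>simp add: nn_integral_distr\<close>)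

text \<open>Relabelling along a bijection sends boxes to boxes of equal volume. It serves to pass
  from the given index type to an ordered copy of it.\<close>

lemma nn_integral_vec_reindex:
  fixes f :: "real ^ 'n::finite \<Rightarrow> ennreal" and e :: "'n \<Rightarrow> 'm::finite"
  assumes e: "bij e" and [measurable]: "f \<in> borel_measurable borel"
  shows "(\<integral>\<^sup>+x. f x \<partial>lborel) = (\<integral>\<^sup>+x. f (\<chi> i. x $ e i) \<partial>(lborel :: (real ^ 'm) measure))"
proof -
  have [measurable]: "(\<lambda>x::real^'m. \<chi> i::'n. x $ e i) \<in> borel_measurable borel"
    by (intro borel_measurable_continuous_onI continuous_intros)
  have eq: "lborel = distr (lborel :: (real ^ 'm) measure) borel (\<lambda>x. \<chi> i::'n. x $ e i)"
  proof (rule lborel_eqI)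
    fix l u :: "real ^ 'n"
    assume le: "\<And>b. b \<in> Basis \<Longrightarrow> l \<bullet> b \<le> u \<bullet> b"
    then have le': "l $ i \<le> u $ i" for i
      using le[of "axis i 1"] by (simp add: inner_axis)
    let ?r = "\<lambda>v::real^'n. \<chi> j. v $ inv e j"
    have inv: "inv e (e i) = i" "e (inv e j) = j" for i j
      using e by (auto simp: bij_is_inj bij_is_surj surj_f_inv_f)
    have *: "(\<lambda>x::real^'m. \<chi> i. x $ e i) -` box l u \<inter> space lborel = box (?r l) (?r u)"
      by (auto simp: mem_box_cart inv) (metis inv)+
    have "(\<Prod>j\<in>UNIV. u $ inv e j - l $ inv e j) = (\<Prod>i\<in>UNIV. u $ i - l $ i)"
      by (rule prod.reindex_bij_betw) (use e bij_imp_bij_inv in blast)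
    then show "emeasure (distr (lborel :: (real ^ 'm) measure) borel (\<lambda>x. \<chi> i. x $ e i)) (box l u)
      = ennreal (\<Prod>b\<in>Basis. (u - l) \<bullet> b)"
      apply (subst emeasure_distr)
        apply simp
       apply simp
      apply (subst *)
      apply (subst emeasure_lborel_box)
      subgoal for b
        using le' by (auto simp: Basis_vec_def inner_axis)
      apply (simp add: prod_Basis_vec inner_axis)
      done
  qed simp
  show ?thesis
    by (subst eq) (simp add: nn_integral_distr)
qed

text \<open>An infinite right-hand side makes the claim trivial. Otherwise \<open>f\<close> is
  integrable and the theorem for absolutely integrable functions yields its integral over the image
  of \<open>S\<close>, which is at most the whole integral because \<open>f\<close> is
  non-negative.\<close>

lemma nn_integral_change_of_variables_le:
  fixes f :: "real ^ 'n::{finite,wellorder} \<Rightarrow> real" and g :: "real ^ 'n::_ \<Rightarrow> real ^ 'n::_"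
  assumes S: "S \<in> sets lebesgue"
    and der: "\<And>x. x \<in> S \<Longrightarrow> (g has_derivative g' x) (at x within S)"
    and inj: "inj_on g S"
    and f [measurable]: "f \<in> borel_measurable borel" and f0: "\<And>x. 0 \<le> f x"
  shows "(\<integral>\<^sup>+x. ennreal (\<bar>det (matrix (g' x))\<bar> * f (g x)) * indicator S x \<partial>lborel) \<le> (\<integral>\<^sup>+x. f x \<partial>lborel)"
proof (cases "(\<integral>\<^sup>+x. f x \<partial>lborel) = \<infinity>")
  case False
  then have int: "integrable lborel f"
    by (intro integrableI_nonneg) (use f0 in \<open>auto simp: less_top\<close>)
  have gS: "g ` S \<in> sets lebesgue"
    by (rule differentiable_image_in_sets_lebesgue[OF S])
      (use der in \<open>auto simp: differentiable_on_def differentiable_def\<close>)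
  have "f absolutely_integrable_on UNIV"
    using int by (simp add: set_integrable_def integrable_completion)
  then have fab: "f absolutely_integrable_on (g ` S)"
    by (rule set_integrable_subset) (use gS in auto)
  define b where "b = integral (g ` S) f"
  \<comment> \<open>The theorem is stated for vector values, so \<open>f\<close> is read as a
    function into \<open>real ^ 1\<close>.\<close>
  have "(\<lambda>x. \<bar>det (matrix (g' x))\<bar> *\<^sub>R f (g x)) absolutely_integrable_on S \<and>
      integral S (\<lambda>x. \<bar>det (matrix (g' x))\<bar> *\<^sub>R f (g x)) = b"
    using has_absolute_integral_change_of_variables[OF S der inj, of "\<lambda>x. vec (f x) :: real ^ 1" "vec b"] fab
    by (simp add: b_def absolutely_integrable_on_1_iff integral_on_1_eq absolutely_integrable_on_def integrable_on_1_iff)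
  then have "((\<lambda>x. \<bar>det (matrix (g' x))\<bar> * f (g x)) has_integral b) S"
    using set_lebesgue_integral_eq_integral(1) by (auto simp: has_integral_integrable_integral)
  then have "(\<integral>\<^sup>+x. ennreal (\<bar>det (matrix (g' x))\<bar> * f (g x)) * indicator S x \<partial>lborel) = ennreal b"
    by (rule nn_integral_has_integral_lebesgue'[rotated]) (use f0 in auto)
  also have "\<dots> \<le> ennreal (integral UNIV f)"
    unfolding b_def
    by (intro ennreal_leI integral_subset_le)
     (use fab f0 \<open>f absolutely_integrable_on UNIV\<close> set_lebesgue_integral_eq_integral(1) in auto)
  also have "integral UNIV f = (\<integral>x. f x \<partial>lborel)"
    using int by (simp add: integral_lborel)
  also have "ennreal \<dots> = (\<integral>\<^sup>+x. f x \<partial>lborel)"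
    using int f0 by (simp add: nn_integral_eq_integral)
  finally show ?thesis .
qed simp

section \<open>Integrals of triangular kernels\<close>

text \<open>The integrand behaves like \<open>\<bar>x\<bar> powr (b - 1)\<close> near 0 and like
  \<open>\<bar>x\<bar> powr (b - a - 1)\<close> at infinity; \<open>0 < b\<close> and
  \<open>b < a\<close> make both integrable there.\<close>

lemma nn_integral_kernel_finite:
  fixes a b :: real
  assumes "0 < b" "b < a"
  shows "(\<integral>\<^sup>+x. ennreal ((1 + \<bar>x\<bar>) powr (-a) * \<bar>x\<bar> powr (b - 1)) \<partial>lborel) < \<infinity>"
proof -
  \<comment> \<open>\<open>\<phi> x\<close> dominates the integrand for \<open>x \<ge> 0\<close>,
    and \<open>\<phi> (- x)\<close> covers the negative half-line.\<close>
  define \<phi> :: "real \<Rightarrow> ennreal" where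
    "\<phi> x = ennreal (x powr (b - 1)) * indicator {0..1} x + ennreal (x powr (b - a - 1)) * indicator {1..} x" for x
  have [measurable]: "\<phi> \<in> borel_measurable borel"
    unfolding \<phi>_def by measurable
  have 1: "(\<integral>\<^sup>+x. ennreal (x powr (b - 1)) * indicator {0..1} x \<partial>lborel)
      = ennreal (1 powr (b - 1 + 1) / (b - 1 + 1))"
    by (rule nn_integral_has_integral_lebesgue') (use assms has_integral_powr_from_0[of "b - 1" 1] in auto)
  have 2: "(\<integral>\<^sup>+x. ennreal (x powr (b - a - 1)) * indicator {1..} x \<partial>lborel)
      = ennreal (- (1 powr (b - a - 1 + 1)) / (b - a - 1 + 1))"
    by (rule nn_integral_has_integral_lebesgue') (use assms has_integral_powr_to_inf[of "b - a - 1" 1] in auto)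
  have fin: "(\<integral>\<^sup>+x. \<phi> x \<partial>lborel) < \<infinity>"
    unfolding \<phi>_def by (subst nn_integral_add) (auto simp only: 1 2, auto)
  have fin': "(\<integral>\<^sup>+x. \<phi> (- x) \<partial>lborel) < \<infinity>"
    using fin nn_integral_real_affine[of \<phi> "-1" 0] by simp
  have "ennreal ((1 + \<bar>x\<bar>) powr (-a) * \<bar>x\<bar> powr (b - 1)) \<le> \<phi> x + \<phi> (- x)" for x
  proof -
    have *: "ennreal ((1 + z) powr (-a) * z powr (b - 1)) \<le> \<phi> z" if z: "z \<ge> 0" for z
    proof (cases "z < 1")
      case True
      have "(1 + z) powr (-a) * z powr (b - 1) \<le> 1 * z powr (b - 1)"
        by (intro mult_right_mono) (use assms z in \<open>auto simp: powr_minus field_simps ge_one_powr_ge_zero\<close>)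
      then show ?thesis
        unfolding \<phi>_def using True z by (auto simp: indicator_def intro: add_increasing2 ennreal_leI)
    next
      case False
      have "(1 + z) powr (-a) * z powr (b - 1) \<le> z powr (-a) * z powr (b - 1)"
        by (intro mult_right_mono powr_mono2') (use assms z False in auto)
      also have "\<dots> = z powr (b - a - 1)"
        using False by (simp add: algebra_simps flip: powr_add)
      finally have "ennreal ((1 + z) powr (-a) * z powr (b - 1)) \<le> ennreal (z powr (b - a - 1)) * indicator {1..} z"
        using False by (simp add: ennreal_leI)
      also have "\<dots> \<le> \<phi> z"
        unfolding \<phi>_def by (rule add_increasing) simp_all
      finally show ?thesis .
    qed
    show ?thesis
      using *[of x] *[of "-x"] by (cases "x \<ge> 0") (auto intro: add_increasing add_increasing2)
  qed
  then have "(\<integral>\<^sup>+x. ennreal ((1 + \<bar>x\<bar>) powr (-a) * \<bar>x\<bar> powr (b - 1)) \<partial>lborel)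
    \<le> (\<integral>\<^sup>+x. \<phi> x + \<phi> (- x) \<partial>lborel)"
    by (intro nn_integral_mono) auto
  also have "\<dots> = (\<integral>\<^sup>+x. \<phi> x \<partial>lborel) + (\<integral>\<^sup>+x. \<phi> (- x) \<partial>lborel)"
    by (rule nn_integral_add) auto
  also have "\<dots> < \<infinity>"
    using fin fin' by simp
  finally show ?thesis .
qed

text \<open>For \<open>B = d = 1\<close> neither factor increases with the absolute value it depends
  on, so the product is at most the unshifted kernel \<open>k\<close> at whichever of
  \<open>x\<close> and \<open>x + c\<close> is smaller in absolute value. This bound is uniform in
  \<open>c\<close>; rescaling \<open>x\<close> by \<open>d * B\<close> gives the general
  case.\<close>

lemma nn_integral_shifted_kernel_le:
  fixes a b :: real
  assumes "0 < b" "b \<le> 1" "b < a"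
  obtains K :: real where "K \<ge> 0"
    "\<And>B d c :: real. 0 < B \<Longrightarrow> 0 < d \<Longrightarrow>
      (\<integral>\<^sup>+x. ennreal ((B + \<bar>x + c\<bar> / d) powr (-a) * \<bar>x\<bar> powr (b - 1)) \<partial>lborel)
        \<le> ennreal (K * d powr b * B powr (b - a))"
proof -
  define k where "k x = (1 + \<bar>x\<bar>) powr (-a) * \<bar>x\<bar> powr (b - 1)" for x :: real
  have [measurable]: "k \<in> borel_measurable borel"
    unfolding k_def by measurable
  define I where "I = enn2real (\<integral>\<^sup>+x. ennreal (k x) \<partial>lborel)"
  have I: "(\<integral>\<^sup>+x. ennreal (k x) \<partial>lborel) = ennreal I" "I \<ge> 0"
    using nn_integral_kernel_finite[OF assms(1,3)] by (auto simp: I_def k_def)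
  have unit: "(\<integral>\<^sup>+x. ennreal ((1 + \<bar>x + c\<bar>) powr (-a) * \<bar>x\<bar> powr (b - 1)) \<partial>lborel) \<le> ennreal (2 * I)" for c
  proof -
    \<comment> \<open>At \<open>x = - c\<close> the second term is 0 because
      \<open>0 powr (b - 1) = 0\<close>, so the bound can fail there; a single point is
      negligible.\<close>
    have le: "(1 + \<bar>x + c\<bar>) powr (-a) * \<bar>x\<bar> powr (b - 1) \<le> k x + k (c + 1 * x)" if "x \<noteq> -c" for x
    proof (cases "\<bar>x\<bar> \<le> \<bar>x + c\<bar>")
      case True
      then have "(1 + \<bar>x + c\<bar>) powr (-a) * \<bar>x\<bar> powr (b - 1) \<le> k x"
        unfolding k_def by (intro mult_right_mono powr_mono2') (use assms in auto)
      then show ?thesis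
        by (simp add: k_def add_increasing2)
    next
      case False
      then have "(1 + \<bar>x + c\<bar>) powr (-a) * \<bar>x\<bar> powr (b - 1) \<le> k (c + 1 * x)"
        unfolding k_def using that
        by (simp add: add.commute) (intro mult_left_mono powr_mono2', use assms in auto)
      then show ?thesis
        by (simp add: k_def add_increasing)
    qed
    then have le': "ennreal ((1 + \<bar>x + c\<bar>) powr (-a) * \<bar>x\<bar> powr (b - 1)) \<le> ennreal (k x) + ennreal (k (c + 1 * x))"
      if "x \<noteq> - c" for x
      using that by (simp add: k_def ennreal_leI flip: ennreal_plus)
    have "AE x in lborel. x \<noteq> - c"
      by (rule AE_lborel_singleton)
    then have "(\<integral>\<^sup>+x. ennreal ((1 + \<bar>x + c\<bar>) powr (-a) * \<bar>x\<bar> powr (b - 1)) \<partial>lborel)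
        \<le> (\<integral>\<^sup>+x. ennreal (k x) + ennreal (k (c + 1 * x)) \<partial>lborel)"
      by (intro nn_integral_mono_AE) (auto elim!: eventually_mono dest: le')
    also have "\<dots> = (\<integral>\<^sup>+x. ennreal (k x) \<partial>lborel) + (\<integral>\<^sup>+x. ennreal (k (c + 1 * x)) \<partial>lborel)"
      by (rule nn_integral_add) auto
    also have "(\<integral>\<^sup>+x. ennreal (k (c + 1 * x)) \<partial>lborel) = (\<integral>\<^sup>+x. ennreal (k x) \<partial>lborel)"
      using nn_integral_real_affine[of "\<lambda>x. ennreal (k x)" 1 c] by simp
    finally show ?thesis
      using I by (simp flip: ennreal_plus)
  qed
  show thesis
  proof (rule that[of "2 * I"])
    fix B d c :: real
    assume B: "0 < B" and d: "0 < d"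
    have "(B + \<bar>d * B * x + c\<bar> / d) powr (-a) * \<bar>d * B * x\<bar> powr (b - 1)
      = B powr (-a) * (d * B) powr (b - 1) * ((1 + \<bar>x + c / (d * B)\<bar>) powr (-a) * \<bar>x\<bar> powr (b - 1))" for x
    proof -
      have "d * B * x + c = d * B * (x + c / (d * B))"
        using B d by (simp add: field_simps)
      then have "\<bar>d * B * x + c\<bar> / d = B * \<bar>x + c / (d * B)\<bar>"
        using B d by (simp add: abs_mult)
      then have "B + \<bar>d * B * x + c\<bar> / d = B * (1 + \<bar>x + c / (d * B)\<bar>)"
        by (simp add: algebra_simps)
      moreover have "\<bar>d * B * x\<bar> = (d * B) * \<bar>x\<bar>"
        using B d by (simp add: abs_mult)
      ultimately show ?thesis
        using B d by (simp only: powr_mult) simp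
    qed
    note eq = this
    have "(\<integral>\<^sup>+x. ennreal ((B + \<bar>x + c\<bar> / d) powr (-a) * \<bar>x\<bar> powr (b - 1)) \<partial>lborel)
      = ennreal (d * B) * (\<integral>\<^sup>+x. ennreal (B powr (-a) * (d * B) powr (b - 1)) *
          ennreal ((1 + \<bar>x + c / (d * B)\<bar>) powr (-a) * \<bar>x\<bar> powr (b - 1)) \<partial>lborel)"
      by (subst nn_integral_real_affine[where c = "d * B" and t = 0])
        (use B d in \<open>simp_all add: eq ennreal_mult\<close>)
    also have "\<dots> \<le> ennreal (d * B) * (ennreal (B powr (-a) * (d * B) powr (b - 1)) * ennreal (2 * I))"
      by (subst nn_integral_cmult) (auto intro!: mult_left_mono unit)
    also have "\<dots> = ennreal (d * B * (B powr (-a) * (d * B) powr (b - 1) * (2 * I)))"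
      using B d I by (simp flip: ennreal_mult)
    also have "d * B * (B powr (-a) * (d * B) powr (b - 1) * (2 * I)) = 2 * I * d powr b * B powr (b - a)"
      using B d by (simp add: powr_mult powr_diff powr_minus field_simps)
    finally show "(\<integral>\<^sup>+x. ennreal ((B + \<bar>x + c\<bar> / d) powr (-a) * \<bar>x\<bar> powr (b - 1)) \<partial>lborel)
      \<le> ennreal (2 * I * d powr b * B powr (b - a))" .
  qed (use I in simp)
qed

text \<open>The linear forms are triangular, so the variables can be integrated out one at a time,
  the largest first.\<close>

lemma nn_integral_triangular_kernel_le:
  fixes s :: real
  assumes s: "1 \<le> s"
  shows "\<exists>C\<ge>0. \<forall>(A :: 'n::{finite,linorder} set) (a :: 'n \<Rightarrow> real) (c :: 'n \<Rightarrow> 'n \<Rightarrow> real) (\<delta> :: 'n \<Rightarrow> real) (\<beta> :: real). card A = m \<longrightarrow> 0 < \<beta> \<longrightarrow> (\<forall>k. 0 < \<delta> k) \<longrightarrow>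
    (\<integral>\<^sup>+x. ennreal ((\<beta> + (\<Sum>k\<in>A. \<bar>x k + (a k + (\<Sum>j\<in>A \<inter> {..<k}. c k j * x j))\<bar> / \<delta> k))
        powr (- (real m + 1) / s) * (\<Prod>k\<in>A. \<bar>x k\<bar> powr (1 / s - 1))) \<partial>PiM A (\<lambda>_. lborel))
    \<le> ennreal (C * \<beta> powr (- 1 / s) * (\<Prod>k\<in>A. \<delta> k powr (1 / s)))"
proof (induction m)
  case 0
  show ?case
    by (rule exI[of _ 1]) (auto simp: PiM_empty nn_integral_count_space_finite)
next
  case (Suc m)
  then obtain C where C: "C \<ge> 0" and IH:
    "\<And>(A :: 'n set) (a :: 'n \<Rightarrow> real) (c :: 'n \<Rightarrow> 'n \<Rightarrow> real) (\<delta> :: 'n \<Rightarrow> real) (\<beta> :: real). card A = m \<Longrightarrow> 0 < \<beta> \<Longrightarrow> (\<And>k. 0 < \<delta> k) \<Longrightarrow>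
    (\<integral>\<^sup>+x. ennreal ((\<beta> + (\<Sum>k\<in>A. \<bar>x k + (a k + (\<Sum>j\<in>A \<inter> {..<k}. c k j * x j))\<bar> / \<delta> k))
        powr (- (real m + 1) / s) * (\<Prod>k\<in>A. \<bar>x k\<bar> powr (1 / s - 1))) \<partial>PiM A (\<lambda>_. lborel))
    \<le> ennreal (C * \<beta> powr (- 1 / s) * (\<Prod>k\<in>A. \<delta> k powr (1 / s)))"
    by meson
  \<comment> \<open>With \<open>m + 1\<close> variables the exponent is
    \<open>- (m + 2) / s\<close>. Integrating out one variable against the weight with exponent
    \<open>1 / s - 1\<close> raises it by \<open>1 / s\<close>, which is the exponent of the
    induction hypothesis.\<close>
  obtain K where K: "K \<ge> 0"
    "\<And>B d c :: real. 0 < B \<Longrightarrow> 0 < d \<Longrightarrow>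
      (\<integral>\<^sup>+x. ennreal ((B + \<bar>x + c\<bar> / d) powr (- ((real m + 2) / s)) * \<bar>x\<bar> powr (1 / s - 1)) \<partial>lborel)
        \<le> ennreal (K * d powr (1 / s) * B powr (1 / s - (real m + 2) / s))"
    using nn_integral_shifted_kernel_le[of "1 / s" "(real m + 2) / s"] s
    by (auto simp: divide_simps)
  interpret product_sigma_finite "\<lambda>_::'n. lborel :: real measure"
    by standard
  show ?case
  proof (intro exI[of _ "K * C"] conjI allI impI)
    fix A :: "'n set" and a \<delta> :: "'n \<Rightarrow> real" and c :: "'n \<Rightarrow> 'n \<Rightarrow> real" and \<beta> :: real
    assume card: "card A = Suc m" and \<beta>: "0 < \<beta>" and "\<forall>k. 0 < \<delta> k"
    then have \<delta>: "0 < \<delta> k" for k by blast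
    \<comment> \<open>The form with index \<open>i\<close> involves only \<open>x i\<close> and
      variables of smaller index, so the variable of largest index occurs in a single form.\<close>
    define k where "k = Max A"
    define A' where "A' = A - {k}"
    have "A \<noteq> {}" using card by auto
    then have kA: "k \<in> A" by (simp add: k_def)
    then have A: "A = insert k A'" "k \<notin> A'" by (auto simp: A'_def)
    have card': "card A' = m" using card kA by (simp add: A'_def)
    have less: "j < k" if "j \<in> A'" for j
      using that Max_ge[of A j] by (auto simp: A'_def k_def order.strict_iff_order)
    define B where "B x = \<beta> + (\<Sum>k\<in>A'. \<bar>x k + (a k + (\<Sum>j\<in>A' \<inter> {..<k}. c k j * x j))\<bar> / \<delta> k)" for x
    define l where "l x = a k + (\<Sum>j\<in>A'. c k j * x j)" for x
    define w where "w x = (\<Prod>k\<in>A'. \<bar>x k\<bar> powr (1 / s - 1))" for x :: "'n \<Rightarrow> real"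
    have B0: "B x > 0" for x
      unfolding B_def by (intro add_pos_nonneg sum_nonneg divide_nonneg_pos \<beta> \<delta>) simp_all
    have w0: "w x \<ge> 0" for x
      unfolding w_def by (intro prod_nonneg) auto
    let ?F = "\<lambda>x. ennreal ((\<beta> + (\<Sum>k\<in>A. \<bar>x k + (a k + (\<Sum>j\<in>A \<inter> {..<k}. c k j * x j))\<bar> / \<delta> k))
        powr (- (real (Suc m) + 1) / s) * (\<Prod>k\<in>A. \<bar>x k\<bar> powr (1 / s - 1)))"
    have [measurable]: "B \<in> borel_measurable (PiM A' (\<lambda>_. lborel))"
      "w \<in> borel_measurable (PiM A' (\<lambda>_. lborel))"
      unfolding B_def w_def by measurable
    have split: "?F (x(k := y)) = ennreal (w x) *
      ennreal ((B x + \<bar>y + l x\<bar> / \<delta> k) powr (- ((real m + 2) / s)) * \<bar>y\<bar> powr (1 / s - 1))" for x y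
    proof -
      have 1: "(\<Sum>j\<in>A \<inter> {..<i}. c i j * (x(k := y)) j) = (\<Sum>j\<in>A' \<inter> {..<i}. c i j * x j)" if "i \<in> A" for i
        by (rule sum.cong) (use A that less in \<open>auto dest: less_imp_not_less\<close>)
      have 2: "A' \<inter> {..<k} = A'" using less by auto
      have 3: "(\<Sum>i\<in>A. \<bar>(x(k := y)) i + (a i + (\<Sum>j\<in>A \<inter> {..<i}. c i j * (x(k := y)) j))\<bar> / \<delta> i)
        = (\<Sum>i\<in>A. \<bar>(x(k := y)) i + (a i + (\<Sum>j\<in>A' \<inter> {..<i}. c i j * x j))\<bar> / \<delta> i)"
        by (rule sum.cong) (simp_all only: 1)
      also have "\<dots> = \<bar>y + l x\<bar> / \<delta> k + (\<Sum>i\<in>A'. \<bar>(x(k := y)) i + (a i + (\<Sum>j\<in>A' \<inter> {..<i}. c i j * x j))\<bar> / \<delta> i)"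
        using A by (simp add: l_def 2)
      also have "(\<Sum>i\<in>A'. \<bar>(x(k := y)) i + (a i + (\<Sum>j\<in>A' \<inter> {..<i}. c i j * x j))\<bar> / \<delta> i)
        = (\<Sum>i\<in>A'. \<bar>x i + (a i + (\<Sum>j\<in>A' \<inter> {..<i}. c i j * x j))\<bar> / \<delta> i)"
        by (rule sum.cong) (use A in auto)
      finally have 4: "\<beta> + (\<Sum>i\<in>A. \<bar>(x(k := y)) i + (a i + (\<Sum>j\<in>A \<inter> {..<i}. c i j * (x(k := y)) j))\<bar> / \<delta> i)
        = B x + \<bar>y + l x\<bar> / \<delta> k"
        by (simp add: B_def)
      have "(\<Prod>i\<in>A. \<bar>(x(k := y)) i\<bar> powr (1 / s - 1)) = \<bar>y\<bar> powr (1 / s - 1) * (\<Prod>i\<in>A'. \<bar>(x(k := y)) i\<bar> powr (1 / s - 1))"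
        using A by simp
      also have "(\<Prod>i\<in>A'. \<bar>(x(k := y)) i\<bar> powr (1 / s - 1)) = w x"
        unfolding w_def by (rule prod.cong) (use A in auto)
      finally have 5: "(\<Prod>i\<in>A. \<bar>(x(k := y)) i\<bar> powr (1 / s - 1)) = \<bar>y\<bar> powr (1 / s - 1) * w x" .
      have 6: "- (real (Suc m) + 1) / s = - ((real m + 2) / s)"
        by (simp only: minus_divide_left) simp
      show ?thesis
        unfolding 4 5 6 using w0 by (simp add: mult_ac flip: ennreal_mult)
    qed
    have "(\<integral>\<^sup>+x. ?F x \<partial>PiM A (\<lambda>_. lborel)) = (\<integral>\<^sup>+x. (\<integral>\<^sup>+y. ?F (x(k := y)) \<partial>lborel) \<partial>PiM A' (\<lambda>_. lborel))"
      unfolding A(1) by (rule product_nn_integral_insert) (use A(2) in simp_all)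
    also have "\<dots> = (\<integral>\<^sup>+x. ennreal (w x) * (\<integral>\<^sup>+y.
      ennreal ((B x + \<bar>y + l x\<bar> / \<delta> k) powr (- ((real m + 2) / s)) * \<bar>y\<bar> powr (1 / s - 1)) \<partial>lborel) \<partial>PiM A' (\<lambda>_. lborel))"
      unfolding split by (intro nn_integral_cong nn_integral_cmult) simp
    also have "\<dots> \<le> (\<integral>\<^sup>+x. ennreal (w x) * ennreal (K * \<delta> k powr (1 / s) * B x powr (1 / s - (real m + 2) / s)) \<partial>PiM A' (\<lambda>_. lborel))"
      by (intro nn_integral_mono mult_left_mono K B0 \<delta>) simp
    also have "\<dots> = (\<integral>\<^sup>+x. ennreal (K * \<delta> k powr (1 / s)) * ennreal (B x powr (- (real m + 1) / s) * w x) \<partial>PiM A' (\<lambda>_. lborel))"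
    proof (rule nn_integral_cong)
      fix x
      have "1 / s - (real m + 2) / s = - (real m + 1) / s"
        using s by (simp add: field_simps)
      then show "ennreal (w x) * ennreal (K * \<delta> k powr (1 / s) * B x powr (1 / s - (real m + 2) / s))
        = ennreal (K * \<delta> k powr (1 / s)) * ennreal (B x powr (- (real m + 1) / s) * w x)"
        using w0[of x] K(1) by (simp add: mult_ac flip: ennreal_mult)
    qed
    also have "\<dots> = ennreal (K * \<delta> k powr (1 / s)) * (\<integral>\<^sup>+x. ennreal (B x powr (- (real m + 1) / s) * w x) \<partial>PiM A' (\<lambda>_. lborel))"
      by (rule nn_integral_cmult) simp
    also have "\<dots> \<le> ennreal (K * \<delta> k powr (1 / s)) * ennreal (C * \<beta> powr (- 1 / s) * (\<Prod>k\<in>A'. \<delta> k powr (1 / s)))"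
      unfolding B_def w_def by (intro mult_left_mono IH card' \<beta> \<delta>) simp
    also have "\<dots> = ennreal (K * C * \<beta> powr (- 1 / s) * (\<Prod>k\<in>A. \<delta> k powr (1 / s)))"
      using A K(1) C by (simp add: mult_ac prod_nonneg flip: ennreal_mult)
    finally show "(\<integral>\<^sup>+x. ?F x \<partial>PiM A (\<lambda>_. lborel)) \<le> ennreal (K * C * \<beta> powr (- 1 / s) * (\<Prod>k\<in>A. \<delta> k powr (1 / s)))" .
  qed (use K C in simp)
qed

section \<open>Monomial coordinates\<close>

text \<open>Each permutation takes exactly one entry from every row and every column, so the same
  factors leave every term of the expansion.\<close>

lemma det_scale_rows_columns:
  fixes A :: "'a::comm_ring_1 ^ 'n ^ 'n"
  shows "det (\<chi> i j. r i * A $ i $ j * c j) = (\<Prod>i\<in>UNIV. r i) * (\<Prod>i\<in>UNIV. c i) * det A"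
proof -
  have "(\<Prod>i\<in>UNIV. c (p i)) = (\<Prod>i\<in>UNIV. c i)" if "p permutes UNIV" for p
    using prod.permute[OF that, of c] by (simp add: comp_def)
  then show ?thesis
    unfolding det_def by (simp add: prod.distrib sum_distrib_left mult_ac)
qed

text \<open>Dividing by \<open>t $ i\<close> separates a factor that depends only on the monomial
  from one that depends only on the coordinate; the Jacobian determinant of all monomials then
  factors by rows and columns.\<close>

lemma has_derivative_multi_power:
  fixes t :: "real ^ 'n"
  assumes "\<And>i. t $ i \<noteq> 0"
  shows "((\<lambda>t. multi_power t a) has_derivative
    (\<lambda>h. \<Sum>i\<in>UNIV. multi_power t a * real (a $ i) * (1 / t $ i) * h $ i)) (at t within S)"
proof -
  have "(\<Prod>j\<in>UNIV. (t $ j) ^ (a $ j)) = (t $ i) ^ (a $ i) * (\<Prod>j\<in>UNIV - {i}. (t $ j) ^ (a $ j))" for i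
    by (rule prod.remove) auto
  moreover have "real (a $ i) * h $ i * (t $ i) ^ (a $ i - 1) = (t $ i) ^ (a $ i) * real (a $ i) * (1 / t $ i) * h $ i" for i h
    using assms[of i] by (cases "a $ i") auto
  ultimately have "real (a $ i) * h $ i * (t $ i) ^ (a $ i - 1) * (\<Prod>j\<in>UNIV - {i}. (t $ j) ^ (a $ j))
    = multi_power t a * real (a $ i) * (1 / t $ i) * h $ i" for i h
    unfolding multi_power_def by simp
  moreover have "((\<lambda>t. multi_power t a) has_derivative (\<lambda>h. \<Sum>i\<in>UNIV.
      (real (a $ i) * h $ i * (t $ i) ^ (a $ i - 1)) * (\<Prod>j\<in>UNIV - {i}. (t $ j) ^ (a $ j)))) (at t within S)"
    unfolding multi_power_def
    by (intro has_derivative_prod has_derivative_power bounded_linear_imp_has_derivative bounded_linear_vec_nth)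
  ultimately show ?thesis by simp
qed

lemma multi_power_measurable [measurable]:
  "(\<lambda>t. multi_power t a) \<in> borel_measurable borel"
  unfolding multi_power_def by (intro borel_measurable_continuous_onI continuous_intros)

lemma abs_multi_power: "\<bar>multi_power t a\<bar> = (\<Prod>i\<in>UNIV. \<bar>t $ i\<bar> ^ (a $ i))"
  unfolding multi_power_def by (simp add: abs_prod power_abs)

lemma ln_abs_multi_power:
  assumes "\<And>i. t $ i \<noteq> 0"
  shows "ln \<bar>multi_power t a\<bar> = (\<Sum>i\<in>UNIV. real (a $ i) * ln \<bar>t $ i\<bar>)"
  using assms unfolding abs_multi_power by (simp add: ln_prod ln_realpow)

text \<open>The condition on the sum of the multiindices enters the Jacobian here: over all
  monomials together, each coordinate has total exponent \<open>\<sigma>\<close>.\<close>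

lemma prod_abs_multi_power:
  assumes "\<And>i. (\<Sum>k\<in>UNIV. \<alpha> k $ i) = \<sigma>"
  shows "(\<Prod>k\<in>UNIV. \<bar>multi_power t (\<alpha> k)\<bar>) = (\<Prod>i\<in>UNIV. \<bar>t $ i\<bar>) ^ \<sigma>"
proof -
  have "(\<Prod>k\<in>UNIV. \<bar>multi_power t (\<alpha> k)\<bar>) = (\<Prod>i\<in>UNIV. \<Prod>k\<in>UNIV. \<bar>t $ i\<bar> ^ (\<alpha> k $ i))"
    unfolding abs_multi_power by (rule prod.swap)
  also have "\<dots> = (\<Prod>i\<in>UNIV. \<bar>t $ i\<bar>) ^ \<sigma>"
    by (simp add: assms prod_power_distrib flip: power_sum)
  finally show ?thesis .
qed

section \<open>The monomial map: injectivity, Jacobian and the transformed kernel\<close>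

definition monomial_map :: "('n \<Rightarrow> nat ^ 'n) \<Rightarrow> real ^ 'n \<Rightarrow> real ^ 'n" where
  "monomial_map \<alpha> t = (\<chi> k. multi_power t (\<alpha> k))"

definition exponent_matrix :: "('n \<Rightarrow> nat ^ 'n) \<Rightarrow> real ^ 'n ^ 'n" where
  "exponent_matrix \<alpha> = (\<chi> k. multiindex_vec (\<alpha> k))"

text \<open>Logarithms recover only the absolute values of the coordinates, so the monomial map is
  treated separately for each sign pattern.\<close>

definition orthant :: "'n set \<Rightarrow> (real ^ 'n) set" where
  "orthant J = {t. \<forall>i. if i \<in> J then 0 < t $ i else t $ i < 0}"

lemma sets_orthant [measurable]: "orthant (J :: 'n::finite set) \<in> sets borel"
proof -
  have "orthant J = (\<Inter>i\<in>UNIV. if i \<in> J then {t. 0 < t $ i} else {t. t $ i < 0})"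
    by (auto simp: orthant_def split: if_splits)
  also have "\<dots> \<in> sets borel"
    by (intro sets.finite_INT)
      (auto intro!: borel_open open_halfspace_component_gt_cart open_halfspace_component_lt_cart)
  finally show ?thesis .
qed

lemma orthant_nonzero: "t \<in> orthant J \<Longrightarrow> t $ i \<noteq> 0"
  unfolding orthant_def by (auto dest: spec[of _ i] split: if_splits)

lemma AE_component_nonzero: "AE t in (lborel :: (real ^ 'n::finite) measure). \<forall>i. t $ i \<noteq> 0"
proof -
  have "AE t in (lborel :: (real ^ 'n) measure). t $ i \<noteq> 0" for i
  proof -
    have "{t :: real ^ 'n. t $ i = 0} \<in> null_sets lebesgue"
      using negligible_standard_hyperplane_cart[of i] by (simp add: negligible_iff_null_sets)
    then have "AE t in (lebesgue :: (real ^ 'n) measure). t \<notin> {t. t $ i = 0}"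
      by (rule AE_not_in)
    then show ?thesis
      by (simp add: AE_completion_iff)
  qed
  then show ?thesis
    by (subst AE_all_countable) auto
qed

text \<open>In the coordinates \<open>ln \<bar>t $ i\<bar>\<close> the map to logarithms of
  monomials is linear with matrix \<open>exponent_matrix \<alpha>\<close>. Hence the absolute values
  agree, and the common orthant fixes the signs.\<close>

lemma inj_on_monomial_map:
  assumes det: "det (exponent_matrix \<alpha>) \<noteq> 0"
  shows "inj_on (monomial_map \<alpha>) (orthant J)"
proof (rule inj_onI)
  fix t u assume t: "t \<in> orthant J" and u: "u \<in> orthant J" and eq: "monomial_map \<alpha> t = monomial_map \<alpha> u"
  define v :: "real ^ 'a" where "v = (\<chi> i. ln (abs (t $ i)) - ln (abs (u $ i)))"
  have "exponent_matrix \<alpha> *v v = 0"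
  proof (subst vec_eq_iff, rule allI)
    fix k
    have "(\<Sum>i\<in>UNIV. real (\<alpha> k $ i) * ln \<bar>t $ i\<bar>) = (\<Sum>i\<in>UNIV. real (\<alpha> k $ i) * ln \<bar>u $ i\<bar>)"
      using arg_cong[OF eq, of "\<lambda>v. v $ k"]
        ln_abs_multi_power[OF orthant_nonzero[OF t], of "\<alpha> k"] ln_abs_multi_power[OF orthant_nonzero[OF u], of "\<alpha> k"]
      by (simp add: monomial_map_def)
    then show "(exponent_matrix \<alpha> *v v) $ k = 0 $ k"
      by (simp add: matrix_vector_mult_def exponent_matrix_def multiindex_vec_def v_def
          right_diff_distrib sum_subtractf)
  qed
  then have "v = 0"
    using det by (metis invertible_det_nz invertible_def matrix_left_invertible_ker)
  then have "ln \<bar>t $ i\<bar> = ln \<bar>u $ i\<bar>" for i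
    by (simp add: v_def vec_eq_iff)
  then have abs: "\<bar>t $ i\<bar> = \<bar>u $ i\<bar>" for i
    using orthant_nonzero[OF t, of i] orthant_nonzero[OF u, of i]
    by (metis ln_inj_iff zero_less_abs_iff)
  show "t = u"
    unfolding vec_eq_iff
  proof
    fix i show "t $ i = u $ i"
      using abs[of i] t u unfolding orthant_def by (auto dest!: spec[of _ i] split: if_splits)
  qed
qed

lemma has_derivative_monomial_map:
  assumes "\<And>i. t $ i \<noteq> 0"
  shows "(monomial_map \<alpha> has_derivative
    (*v) (\<chi> k i. multi_power t (\<alpha> k) * exponent_matrix \<alpha> $ k $ i * (1 / t $ i))) (at t within S)"
proof -
  have "((\<lambda>t. \<chi> k. multi_power t (\<alpha> k)) has_derivative
     (\<lambda>h. \<chi> k. \<Sum>i\<in>UNIV. multi_power t (\<alpha> k) * real (\<alpha> k $ i) * (1 / t $ i) * h $ i)) (at t within S)"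
  proof (subst has_derivative_componentwise_within, safe)
    fix b :: "real ^ 'a" assume "b \<in> Basis"
    then obtain k where "b = axis k 1"
      by (auto simp: Basis_vec_def)
    then show "((\<lambda>t. (\<chi> k. multi_power t (\<alpha> k)) \<bullet> b) has_derivative
       (\<lambda>h. (\<chi> k. \<Sum>i\<in>UNIV. multi_power t (\<alpha> k) * real (\<alpha> k $ i) * (1 / t $ i) * h $ i) \<bullet> b)) (at t within S)"
      using has_derivative_multi_power[OF assms, where a = "\<alpha> k"] by (simp add: inner_axis)
  qed
  moreover have "(*v) (\<chi> k i. multi_power t (\<alpha> k) * exponent_matrix \<alpha> $ k $ i * (1 / t $ i))
    = (\<lambda>h. \<chi> k. \<Sum>i\<in>UNIV. multi_power t (\<alpha> k) * real (\<alpha> k $ i) * (1 / t $ i) * h $ i)"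
    by (auto simp: fun_eq_iff vec_eq_iff matrix_vector_mult_def exponent_matrix_def multiindex_vec_def)
  ultimately show ?thesis
    unfolding monomial_map_def[abs_def] by simp
qed

text \<open>With the monomials as new variables the forms are triangular, and on each orthant the
  Jacobian cancels the weight of the triangular kernel up to the constant \<open>D\<close>.\<close>

lemma nn_integral_monomial_kernel_le:
  fixes \<alpha> :: "'n::{finite,wellorder} \<Rightarrow> (nat, 'n) vec"
  assumes det: "det (exponent_matrix \<alpha>) \<noteq> 0"
    and sum: "\<And>i. (\<Sum>k\<in>UNIV. \<alpha> k $ i) = \<sigma>" and \<sigma>: "0 < \<sigma>"
  shows "\<exists>K\<ge>0. \<forall>(a :: 'n \<Rightarrow> real) (c :: 'n \<Rightarrow> 'n \<Rightarrow> real) (\<delta> :: 'n \<Rightarrow> real) (\<beta> :: real).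
    0 < \<beta> \<longrightarrow> (\<forall>k. 0 < \<delta> k) \<longrightarrow>
    (\<integral>\<^sup>+t. ennreal ((\<beta> + (\<Sum>k\<in>UNIV. \<bar>multi_power t (\<alpha> k) + (a k + (\<Sum>j\<in>{..<k}. c k j * multi_power t (\<alpha> j)))\<bar> / \<delta> k))
        powr (- (real CARD('n) + 1) / real \<sigma>)) \<partial>lborel)
    \<le> ennreal (K * \<beta> powr (- 1 / real \<sigma>) * (\<Prod>k\<in>UNIV. \<delta> k powr (1 / real \<sigma>)))"
proof -
  obtain C where C: "C \<ge> 0" and bound:
    "\<And>(A :: 'n set) (a :: 'n \<Rightarrow> real) (c :: 'n \<Rightarrow> 'n \<Rightarrow> real) (\<delta> :: 'n \<Rightarrow> real) (\<beta> :: real).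
      card A = CARD('n) \<Longrightarrow> 0 < \<beta> \<Longrightarrow> (\<And>k. 0 < \<delta> k) \<Longrightarrow>
    (\<integral>\<^sup>+x. ennreal ((\<beta> + (\<Sum>k\<in>A. \<bar>x k + (a k + (\<Sum>j\<in>A \<inter> {..<k}. c k j * x j))\<bar> / \<delta> k))
        powr (- (real CARD('n) + 1) / real \<sigma>) * (\<Prod>k\<in>A. \<bar>x k\<bar> powr (1 / real \<sigma> - 1))) \<partial>PiM A (\<lambda>_. lborel))
    \<le> ennreal (C * \<beta> powr (- 1 / real \<sigma>) * (\<Prod>k\<in>A. \<delta> k powr (1 / real \<sigma>)))"
    using nn_integral_triangular_kernel_le[of "real \<sigma>" "CARD('n)", where 'n = 'n] \<sigma> by (auto simp: Suc_le_eq)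
  define D where "D = \<bar>det (exponent_matrix \<alpha>)\<bar>"
  have D: "D > 0" using det by (simp add: D_def)
  show ?thesis
  \<comment> \<open>\<open>2 ^ CARD('n)\<close> counts the orthants, \<open>C\<close> belongs to the
    triangular kernel, and \<open>D\<close> is the constant in the Jacobian.\<close>
  proof (intro exI[of _ "2 ^ CARD('n) * C / D"] conjI allI impI)
    fix a :: "'n \<Rightarrow> real" and c :: "'n \<Rightarrow> 'n \<Rightarrow> real" and \<delta> :: "'n \<Rightarrow> real" and \<beta> :: real
    assume \<beta>: "0 < \<beta>" and "\<forall>k. 0 < \<delta> k"
    then have \<delta>: "0 < \<delta> k" for k by blast
    define V where "V x = (\<beta> + (\<Sum>k\<in>UNIV. \<bar>x $ k + (a k + (\<Sum>j\<in>{..<k}. c k j * x $ j))\<bar> / \<delta> k))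
        powr (- (real CARD('n) + 1) / real \<sigma>)" for x :: "(real, 'n) vec"
    define f where "f x = V x * (\<Prod>k\<in>UNIV. \<bar>x $ k\<bar> powr (1 / real \<sigma> - 1))" for x :: "(real, 'n) vec"
    have [measurable]: "monomial_map \<alpha> \<in> borel_measurable borel"
      unfolding monomial_map_def[abs_def] multi_power_def
      by (intro borel_measurable_continuous_onI continuous_intros)
    have V_meas [measurable]: "V \<in> borel_measurable borel"
      unfolding V_def by measurable
    have [measurable]: "f \<in> borel_measurable borel"
      unfolding f_def by measurable
    have f0: "f x \<ge> 0" for x
      unfolding f_def V_def by (intro mult_nonneg_nonneg prod_nonneg) auto
    define R where "R = C * \<beta> powr (- 1 / real \<sigma>) * (\<Prod>k\<in>UNIV. \<delta> k powr (1 / real \<sigma>))"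
    have R0: "R \<ge> 0" unfolding R_def using C by (intro mult_nonneg_nonneg prod_nonneg) auto
    have int_f: "(\<integral>\<^sup>+x. f x \<partial>lborel) \<le> ennreal R"
      using bound[of UNIV \<beta> \<delta> a c] \<beta> \<delta>
      by (subst nn_integral_vec) (auto simp: f_def V_def R_def)
    let ?g = "monomial_map \<alpha>"
    define g' where "g' t = (*v) (\<chi> k i. multi_power t (\<alpha> k) * exponent_matrix \<alpha> $ k $ i * (1 / t $ i))" for t
    \<comment> \<open>Since \<open>X = T ^ \<sigma>\<close>, the Jacobian factor
      \<open>X / T\<close> equals \<open>X powr (1 - 1 / \<sigma>)\<close>, the reciprocal of the
      weight in \<open>f\<close>.\<close>
    have jac: "\<bar>det (matrix (g' t))\<bar> * f (?g t) = D * V (?g t)" if t: "t \<in> orthant J" for t J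
    proof -
      note nz = orthant_nonzero[OF t]
      define X where "X = (\<Prod>k\<in>UNIV. \<bar>multi_power t (\<alpha> k)\<bar>)"
      define T where "T = (\<Prod>i\<in>UNIV. \<bar>t $ i\<bar>)"
      have T: "T > 0" unfolding T_def using nz by (intro prod_pos) simp
      have XT: "X = T ^ \<sigma>" unfolding X_def T_def by (rule prod_abs_multi_power[OF sum])
      have 1: "\<bar>det (matrix (g' t))\<bar> = X * (1 / T) * D"
        unfolding g'_def D_def X_def T_def matrix_of_matrix_vector_mul det_scale_rows_columns
        by (simp add: abs_mult abs_prod prod_dividef)
      have 2: "(\<Prod>k\<in>UNIV. \<bar>?g t $ k\<bar> powr (1 / real \<sigma> - 1)) = X powr (1 / real \<sigma> - 1)"
        unfolding X_def monomial_map_def by (simp add: prod_powr_distrib)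
      have 3: "X * (1 / T) * X powr (1 / real \<sigma> - 1) = 1"
      proof -
        have "X powr (1 / real \<sigma>) = T"
          using T \<sigma> by (simp add: XT powr_powr flip: powr_realpow)
        moreover have "X > 0" using T XT by simp
        ultimately show ?thesis
          using T by (simp add: powr_diff)
      qed
      have "\<bar>det (matrix (g' t))\<bar> * f (?g t) = (X * (1 / T) * X powr (1 / real \<sigma> - 1)) * (D * V (?g t))"
        unfolding f_def 1 2 by (simp only: mult_ac)
      then show ?thesis
        unfolding 3 by simp
    qed
    have der: "(?g has_derivative g' t) (at t within orthant J)" if "t \<in> orthant J" for t J
      unfolding g'_def by (rule has_derivative_monomial_map) (rule orthant_nonzero[OF that])
    have piece: "(\<integral>\<^sup>+t. ennreal (V (?g t)) * indicator (orthant J) t \<partial>lborel) \<le> ennreal (R / D)" for J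
    proof -
      have "ennreal D * (\<integral>\<^sup>+t. ennreal (V (?g t)) * indicator (orthant J) t \<partial>lborel)
        = (\<integral>\<^sup>+t. ennreal D * (ennreal (V (?g t)) * indicator (orthant J) t) \<partial>lborel)"
        by (rule nn_integral_cmult[symmetric]) simp
      also have "\<dots> = (\<integral>\<^sup>+t. ennreal (\<bar>det (matrix (g' t))\<bar> * f (?g t)) * indicator (orthant J) t \<partial>lborel)"
      proof (rule nn_integral_cong)
        fix t
        show "ennreal D * (ennreal (V (?g t)) * indicator (orthant J) t)
          = ennreal (\<bar>det (matrix (g' t))\<bar> * f (?g t)) * indicator (orthant J) t"
          using D by (cases "t \<in> orthant J") (simp_all add: jac ennreal_mult V_def)
      qed
      also have "\<dots> \<le> (\<integral>\<^sup>+x. f x \<partial>lborel)"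
        by (rule nn_integral_change_of_variables_le)
          (use f0 der inj_on_monomial_map[OF det] in auto)
      also note int_f
      finally have *: "ennreal D * (\<integral>\<^sup>+t. ennreal (V (?g t)) * indicator (orthant J) t \<partial>lborel) \<le> ennreal R" .
      have "(\<integral>\<^sup>+t. ennreal (V (?g t)) * indicator (orthant J) t \<partial>lborel)
        = ennreal (1 / D) * (ennreal D * (\<integral>\<^sup>+t. ennreal (V (?g t)) * indicator (orthant J) t \<partial>lborel))"
        using D by (simp add: mult.assoc[symmetric] flip: ennreal_mult)
      also have "\<dots> \<le> ennreal (1 / D) * ennreal R"
        by (intro mult_left_mono *) simp
      also have "\<dots> = ennreal (R / D)"
        using D R0 by (simp flip: ennreal_mult)
      finally show ?thesis .
    qed
    have "AE t in lborel. ennreal (V (?g t)) \<le> (\<Sum>J\<in>UNIV. ennreal (V (?g t)) * indicator (orthant J) t)"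
      using AE_component_nonzero
    proof eventually_elim
      case (elim t)
      let ?J = "{i. t $ i > 0}"
      have "t \<in> orthant ?J"
        using elim by (auto simp: orthant_def not_less order.strict_iff_order)
      then have "ennreal (V (?g t)) \<le> ennreal (V (?g t)) * indicator (orthant ?J) t"
        by simp
      also have "\<dots> \<le> (\<Sum>J\<in>UNIV. ennreal (V (?g t)) * indicator (orthant J) t)"
        by (rule member_le_sum) auto
      finally show ?case .
    qed
    then have "(\<integral>\<^sup>+t. ennreal (V (?g t)) \<partial>lborel)
      \<le> (\<integral>\<^sup>+t. (\<Sum>J\<in>UNIV. ennreal (V (?g t)) * indicator (orthant J) t) \<partial>lborel)"
      by (rule nn_integral_mono_AE)
    also have "\<dots> = (\<Sum>J\<in>UNIV. \<integral>\<^sup>+t. ennreal (V (?g t)) * indicator (orthant J) t \<partial>lborel)"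
      by (rule nn_integral_sum) simp
    also have "\<dots> \<le> (\<Sum>J\<in>(UNIV :: 'n set set). ennreal (R / D))"
      by (intro sum_mono piece)
    also have "\<dots> = ennreal (2 ^ CARD('n) * (R / D))"
    proof -
      have "(2 :: ennreal) ^ CARD('n) = ennreal (2 ^ CARD('n))"
        by (metis ennreal_numeral ennreal_power zero_le_numeral)
      then show ?thesis
        using R0 D by (simp add: card_UNIV_set del: times_divide_eq_right flip: ennreal_mult)
    qed
    also have "2 ^ CARD('n) * (R / D) = 2 ^ CARD('n) * C / D * \<beta> powr (- 1 / real \<sigma>) * (\<Prod>k\<in>UNIV. \<delta> k powr (1 / real \<sigma>))"
      unfolding R_def by (simp add: field_simps)
    finally show "(\<integral>\<^sup>+t. ennreal ((\<beta> + (\<Sum>k\<in>UNIV. \<bar>multi_power t (\<alpha> k) + (a k + (\<Sum>j\<in>{..<k}. c k j * multi_power t (\<alpha> j)))\<bar> / \<delta> k))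
        powr (- (real CARD('n) + 1) / real \<sigma>)) \<partial>lborel)
      \<le> ennreal (2 ^ CARD('n) * C / D * \<beta> powr (- 1 / real \<sigma>) * (\<Prod>k\<in>UNIV. \<delta> k powr (1 / real \<sigma>)))"
      by (simp add: V_def monomial_map_def)
  qed (use C D in simp)
qed

section \<open>Determinants of sampled functions\<close>

text \<open>The identity matrix outside \<open>A \<times> A\<close> makes its determinant the \<open>A \<times> A\<close> minor.\<close>

definition sample_matrix :: "('n \<Rightarrow> 'a \<Rightarrow> real) \<Rightarrow> 'n set \<Rightarrow> ('n \<Rightarrow> 'a) \<Rightarrow> real ^ 'n ^ 'n" where
  "sample_matrix Q A T = (\<chi> i j. if i \<in> A \<and> j \<in> A then Q j (T i) else if i = j then 1 else 0)"

text \<open>The two matrices differ only in column \<open>b\<close>, outside row \<open>b\<close>. A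
  permutation that moves \<open>b\<close> meets a zero in row \<open>b\<close>; one that fixes
  \<open>b\<close> takes no other entry of that column.\<close>

lemma det_sample_matrix_axis:
  assumes "b \<notin> A"
  shows "det (\<chi> i. if i = b then axis b 1 else sample_matrix Q (insert b A) T $ i) = det (sample_matrix Q A T)"
  (is "det ?N = _")
proof -
  have "(\<Prod>i\<in>UNIV. ?N $ i $ p i) = (\<Prod>i\<in>UNIV. sample_matrix Q A T $ i $ p i)"
    if p: "p permutes UNIV" for p
  proof (cases "p b = b")
    case True
    have ne: "p i \<noteq> b" if "i \<noteq> b" for i
      using p True that by (metis permutes_inv_eq)
    show ?thesis
      by (rule prod.cong) (use assms True ne in \<open>auto simp: sample_matrix_def axis_def\<close>)
  next
    case False
    have "(\<Prod>i\<in>UNIV. ?N $ i $ p i) = 0"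
      by (rule prod_zero[OF finite bexI[of _ b]]) (use False in \<open>auto simp: axis_def\<close>)
    moreover have "(\<Prod>i\<in>UNIV. sample_matrix Q A T $ i $ p i) = 0"
      by (rule prod_zero[OF finite bexI[of _ b]]) (use False assms in \<open>auto simp: sample_matrix_def\<close>)
    ultimately show ?thesis by (simp only:)
  qed
  then show ?thesis
    unfolding det_def by (intro sum.cong) auto
qed

text \<open>Only row \<open>b\<close> depends on \<open>t\<close>, and the determinant is linear in
  that row. The coefficient of \<open>Q b t\<close> is the minor without \<open>b\<close>; the other
  coefficients do not involve \<open>t\<close>.\<close>

lemma det_sample_matrix_insert:
  assumes b: "b \<notin> A"
  obtains D where "\<And>t. det (sample_matrix Q (insert b A) (T(b := t)))
    = det (sample_matrix Q A T) * Q b t + (\<Sum>j\<in>A. D j * Q j t)"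
proof
  define D where "D j = det (\<chi> i. if i = b then axis j 1 else sample_matrix Q (insert b A) T $ i)" for j
  fix t
  have "sample_matrix Q (insert b A) (T(b := t)) =
    (\<chi> i. if i = b then (\<Sum>j\<in>insert b A. Q j t *s axis j 1) else sample_matrix Q (insert b A) T $ i)"
    by (auto simp: vec_eq_iff sample_matrix_def axis_def if_distrib[of "(*) _"] sum.delta cong: if_cong)
  also have "det \<dots> = (\<Sum>j\<in>insert b A. Q j t * D j)"
    by (subst det_linear_row_sum) (simp_all add: det_row_mul D_def)
  also have "\<dots> = det (sample_matrix Q A T) * Q b t + (\<Sum>j\<in>A. D j * Q j t)"
    using b det_sample_matrix_axis[OF b, of Q T] by (simp add: D_def mult.commute)
  finally show "det (sample_matrix Q (insert b A) (T(b := t)))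
    = det (sample_matrix Q A T) * Q b t + (\<Sum>j\<in>A. D j * Q j t)" .
qed

lemma measurable_det [measurable]:
  assumes [measurable]: "\<And>i j. (\<lambda>x. A x $ i $ j) \<in> borel_measurable M"
  shows "(\<lambda>x. det (A x) :: real) \<in> borel_measurable M"
  unfolding det_def by measurable

lemma measurable_det_sample_matrix [measurable]:
  assumes [measurable]: "\<And>j. Q j \<in> borel_measurable M"
  shows "(\<lambda>T. det (sample_matrix Q A T)) \<in> borel_measurable (PiM A (\<lambda>_. M))"
proof (rule measurable_det)
  fix i j
  show "(\<lambda>T. sample_matrix Q A T $ i $ j) \<in> borel_measurable (PiM A (\<lambda>_. M))"
    by (cases "i \<in> A"; cases "j \<in> A") (simp_all add: sample_matrix_def)
qed

text \<open>Indices are added in increasing order. With all earlier sample points fixed, the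
  determinant is the previous minor times a sum of \<open>P b\<close> and a combination of 1 and the
  \<open>P j\<close> with \<open>j < b\<close>, so integrating over the newest point gains a factor
  of at least \<open>d b\<close>.\<close>

lemma prod_le_nn_integral_det:
  fixes P :: "'n::{finite,linorder} \<Rightarrow> 'a \<Rightarrow> real" and h :: "'a \<Rightarrow> ennreal" and d :: "'n \<Rightarrow> ennreal"
  assumes "sigma_finite_measure M"
    and P [measurable]: "\<And>k. P k \<in> borel_measurable M" and h [measurable]: "h \<in> borel_measurable M"
    and d: "\<And>k a c. d k \<le> (\<integral>\<^sup>+t. ennreal \<bar>P k t + (a + (\<Sum>j\<in>{..<k}. c j * P j t))\<bar> * h t \<partial>M)"
  shows "(\<Prod>k\<in>A. d k) \<le> (\<integral>\<^sup>+T. ennreal \<bar>det (sample_matrix (\<lambda>k t. P k t - u k) A T)\<bar> *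
    (\<Prod>k\<in>A. h (T k)) \<partial>PiM A (\<lambda>_. M))"
proof (induction A rule: finite_linorder_max_induct[OF finite])
  case 1
  have "sample_matrix (\<lambda>k t. P k t - u k) {} T = mat 1" for T
    by (auto simp: sample_matrix_def mat_def vec_eq_iff)
  then show ?case
    by (simp add: PiM_empty)
next
  case (2 b A)
  interpret product_sigma_finite "\<lambda>_::'n. M"
    using assms(1) by (simp add: product_sigma_finite_def)
  let ?Q = "\<lambda>k t. P k t - u k"
  have b: "b \<notin> A" using 2 by auto
  let ?F = "\<lambda>A T. ennreal \<bar>det (sample_matrix ?Q A T)\<bar> * (\<Prod>k\<in>A. h (T k))"
  have [measurable]: "?F A \<in> borel_measurable (PiM A (\<lambda>_. M))" for A
    by measurable
  have inner: "d b * ?F A T \<le> (\<integral>\<^sup>+t. ?F (insert b A) (T(b := t)) \<partial>M)" for T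
  proof -
    define m where "m = det (sample_matrix ?Q A T)"
    obtain D where D: "\<And>t. det (sample_matrix ?Q (insert b A) (T(b := t)))
      = m * ?Q b t + (\<Sum>j\<in>A. D j * ?Q j t)"
      using det_sample_matrix_insert[OF b, of ?Q T] unfolding m_def by blast
    have hT: "(\<Prod>k\<in>insert b A. h ((T(b := t)) k)) = h t * (\<Prod>k\<in>A. h (T k))" for t
    proof -
      have "(\<Prod>k\<in>A. h ((T(b := t)) k)) = (\<Prod>k\<in>A. h (T k))"
        by (rule prod.cong) (use b in auto)
      then show ?thesis using b by simp
    qed
    show ?thesis
    proof (cases "m = 0")
      case False
      \<comment> \<open>These are the coefficients of the expansion divided by the minor
        \<open>m\<close>. The shifts \<open>u\<close> only change the constant term and are absorbed
        into \<open>a\<close>.\<close>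
      define c where "c j = (if j \<in> A then D j / m else 0)" for j
      define a where "a = - u b - (\<Sum>j\<in>{..<b}. c j * u j)"
      have det_eq: "det (sample_matrix ?Q (insert b A) (T(b := t))) = m * (P b t + (a + (\<Sum>j\<in>{..<b}. c j * P j t)))" for t
      proof -
        have "(\<Sum>j\<in>A. D j * ?Q j t) = (\<Sum>j\<in>A. m * (c j * ?Q j t))"
          by (rule sum.cong) (use False in \<open>auto simp: c_def\<close>)
        also have "\<dots> = (\<Sum>j\<in>{..<b}. m * (c j * ?Q j t))"
          by (rule sum.mono_neutral_left) (use 2 in \<open>auto simp: c_def\<close>)
        also have "\<dots> = m * (\<Sum>j\<in>{..<b}. c j * ?Q j t)"
          by (rule sum_distrib_left[symmetric])
        finally show ?thesis
          unfolding D a_def by (simp add: algebra_simps sum_subtractf)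
      qed
      have "d b * ?F A T \<le> (\<integral>\<^sup>+t. ennreal \<bar>P b t + (a + (\<Sum>j\<in>{..<b}. c j * P j t))\<bar> * h t \<partial>M) * ?F A T"
        by (intro mult_right_mono d) simp
      also have "\<dots> = (\<integral>\<^sup>+t. ennreal \<bar>P b t + (a + (\<Sum>j\<in>{..<b}. c j * P j t))\<bar> * h t * ?F A T \<partial>M)"
        by (rule nn_integral_multc[symmetric]) measurable
      also have "\<dots> = (\<integral>\<^sup>+t. ?F (insert b A) (T(b := t)) \<partial>M)"
        unfolding hT det_eq by (simp add: m_def abs_mult ennreal_mult mult_ac)
      finally show ?thesis .
    qed (simp add: m_def)
  qed
  have "(\<Prod>k\<in>insert b A. d k) = d b * (\<Prod>k\<in>A. d k)"
    using b by simp
  also have "\<dots> \<le> d b * (\<integral>\<^sup>+T. ?F A T \<partial>PiM A (\<lambda>_. M))"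
    by (intro mult_left_mono 2) simp
  also have "\<dots> = (\<integral>\<^sup>+T. d b * ?F A T \<partial>PiM A (\<lambda>_. M))"
    by (rule nn_integral_cmult[symmetric]) measurable
  also have "\<dots> \<le> (\<integral>\<^sup>+T. \<integral>\<^sup>+t. ?F (insert b A) (T(b := t)) \<partial>M \<partial>PiM A (\<lambda>_. M))"
    by (intro nn_integral_mono inner)
  also have "\<dots> = (\<integral>\<^sup>+T. ?F (insert b A) T \<partial>PiM (insert b A) (\<lambda>_. M))"
    by (rule product_nn_integral_insert[symmetric]) (use b in simp_all)
  finally show ?case .
qed

section \<open>The determinant inequality\<close>

text \<open>If \<open>g\<close> exceeds the first term, then
  \<open>g = g powr p * g powr (1 - p)\<close> with \<open>1 - p < 0\<close> is at most the second.
  This replaces Hoelder's inequality, and \<open>\<theta>\<close> remains free to balance the two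
  integrals.\<close>

lemma le_weighted_split:
  fixes g W \<theta> p r :: real
  assumes "0 \<le> g" "0 < W" "0 < \<theta>" "1 < p" "r * (p - 1) = 1"
  shows "g \<le> \<theta> * W powr (- r) + \<theta> powr (1 - p) * (W * g powr p)"
proof (cases "g \<le> \<theta> * W powr (- r)")
  case True
  then show ?thesis
    using assms by (simp add: add_increasing2)
next
  case False
  have pos: "0 < \<theta> * W powr (- r)" using assms by simp
  have g: "g > 0" using False pos by linarith
  have "g powr (1 - p) \<le> (\<theta> * W powr (- r)) powr (1 - p)"
    by (rule powr_mono2') (use assms False pos in auto)
  also have "\<dots> = \<theta> powr (1 - p) * W powr (r * (p - 1))"
    using assms by (simp add: powr_mult powr_powr algebra_simps)
  also have "\<dots> = \<theta> powr (1 - p) * W"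
    using assms by simp
  finally have "g powr p * g powr (1 - p) \<le> g powr p * (\<theta> powr (1 - p) * W)"
    by (rule mult_left_mono) simp
  moreover have "g powr p * g powr (1 - p) = g"
    using g by (simp flip: powr_add)
  moreover have "0 \<le> \<theta> * W powr (- r)" using pos by simp
  ultimately show ?thesis by (simp add: mult_ac)
qed

text \<open>The moment bounds control the integral of \<open>W * g powr p\<close>, the monomial
  kernel controls a negative power of \<open>W\<close>, and the pointwise split joins the two. The
  bounds are arbitrary positive numbers, so that \<open>W\<close> can be formed even if a moment
  vanishes.\<close>

lemma nn_integral_power_le_moments:
  fixes \<alpha> :: "'n::{finite,wellorder} \<Rightarrow> (nat, 'n) vec"
  assumes det: "det (exponent_matrix \<alpha>) \<noteq> 0"
    and sum: "\<And>i. (\<Sum>k\<in>UNIV. \<alpha> k $ i) = \<sigma>" and \<sigma>: "0 < \<sigma>"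
    and p: "p = (real CARD('n) + 1 + real \<sigma>) / (real CARD('n) + 1)"
  obtains C :: real where "C \<ge> 0"
    "\<And>(g :: (real, 'n) vec \<Rightarrow> real) \<delta>\<^sub>0 (\<delta> :: 'n \<Rightarrow> real) (a :: 'n \<Rightarrow> real) (c :: 'n \<Rightarrow> 'n \<Rightarrow> real).
      g \<in> borel_measurable borel \<Longrightarrow> (\<And>t. 0 \<le> g t) \<Longrightarrow> 0 < \<delta>\<^sub>0 \<Longrightarrow> (\<And>k. 0 < \<delta> k) \<Longrightarrow>
      (\<integral>\<^sup>+t. ennreal (g t powr p) \<partial>lborel) \<le> ennreal \<delta>\<^sub>0 \<Longrightarrow>
      (\<And>k. (\<integral>\<^sup>+t. ennreal \<bar>multi_power t (\<alpha> k) + (a k + (\<Sum>j\<in>{..<k}. c k j * multi_power t (\<alpha> j)))\<bar>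
          * ennreal (g t powr p) \<partial>lborel) \<le> ennreal (\<delta> k)) \<Longrightarrow>
      (\<integral>\<^sup>+t. ennreal (g t) \<partial>lborel) ^ (CARD('n) + 1 + \<sigma>) \<le> ennreal (C * (\<delta>\<^sub>0 * (\<Prod>k\<in>UNIV. \<delta> k)))"
proof -
  \<comment> \<open>Here \<open>n\<close> is the number of sample points, one more than the
    dimension.\<close>
  define n where "n = real CARD('n) + 1"
  define s where "s = real \<sigma>"
  have n: "n > 0" and s: "s > 0" using \<sigma> by (auto simp: n_def s_def)
  have p': "p = (n + s) / n" using p by (simp add: n_def s_def)
  have p1: "p > 1" using n s by (simp add: p')
  obtain K0 where "K0 \<ge> 0" and K0:
    "\<And>(a :: 'n \<Rightarrow> real) (c :: 'n \<Rightarrow> 'n \<Rightarrow> real) (\<delta> :: 'n \<Rightarrow> real) (\<beta> :: real).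
    0 < \<beta> \<Longrightarrow> (\<And>k. 0 < \<delta> k) \<Longrightarrow>
    (\<integral>\<^sup>+t. ennreal ((\<beta> + (\<Sum>k\<in>UNIV. \<bar>multi_power t (\<alpha> k) + (a k + (\<Sum>j\<in>{..<k}. c k j * multi_power t (\<alpha> j)))\<bar> / \<delta> k))
        powr (- n / s)) \<partial>lborel)
    \<le> ennreal (K0 * \<beta> powr (- 1 / s) * (\<Prod>k\<in>UNIV. \<delta> k powr (1 / s)))"
    using nn_integral_monomial_kernel_le[OF det sum \<sigma>] unfolding n_def s_def by blast
  \<comment> \<open>\<open>K0\<close> may be 0; the added 1 keeps \<open>L\<close> positive, as a
    negative power of \<open>L\<close> is taken below.\<close>
  define K where "K = K0 + 1"
  have K: "K > 0" using \<open>K0 \<ge> 0\<close> by (simp add: K_def)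
  show thesis
  proof (rule that[of "(n + 1) ^ (CARD('n) + 1 + \<sigma>) * K powr s"])
    show "0 \<le> (n + 1) ^ (CARD('n) + 1 + \<sigma>) * K powr s" using n by simp
    fix g :: "(real, 'n) vec \<Rightarrow> real" and \<delta>\<^sub>0 :: real and \<delta> :: "'n \<Rightarrow> real" and a :: "'n \<Rightarrow> real"
      and c :: "'n \<Rightarrow> 'n \<Rightarrow> real"
    let ?w = "\<lambda>k t. multi_power t (\<alpha> k) + (a k + (\<Sum>j\<in>{..<k}. c k j * multi_power t (\<alpha> j)))"
    assume g [measurable]: "g \<in> borel_measurable borel" and g0: "\<And>t. 0 \<le> g t"
      and \<delta>0: "0 < \<delta>\<^sub>0" and \<delta>: "\<And>k. 0 < \<delta> k"
      and m0: "(\<integral>\<^sup>+t. ennreal (g t powr p) \<partial>lborel) \<le> ennreal \<delta>\<^sub>0"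
      and m: "\<And>k. (\<integral>\<^sup>+t. ennreal \<bar>?w k t\<bar> * ennreal (g t powr p) \<partial>lborel) \<le> ennreal (\<delta> k)"
    define W where "W t = 1 / \<delta>\<^sub>0 + (\<Sum>k\<in>UNIV. \<bar>?w k t\<bar> / \<delta> k)" for t
    have W: "W t > 0" for t
      unfolding W_def by (intro add_pos_nonneg sum_nonneg divide_nonneg_pos \<delta>) (use \<delta>0 in auto)
    have [measurable]: "W \<in> borel_measurable borel" unfolding W_def by measurable
    define \<Delta> where "\<Delta> = \<delta>\<^sub>0 * (\<Prod>k\<in>UNIV. \<delta> k)"
    have \<Delta>: "\<Delta> > 0" unfolding \<Delta>_def using \<delta>0 \<delta> by (simp add: prod_pos)
    define L where "L = K * \<Delta> powr (1 / s)"
    have L: "L > 0" using K \<Delta> by (simp add: L_def)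
    have kernel: "(\<integral>\<^sup>+t. ennreal (W t powr (- (n / s))) \<partial>lborel) \<le> ennreal L"
    proof -
      have "(\<integral>\<^sup>+t. ennreal (W t powr (- (n / s))) \<partial>lborel)
        \<le> ennreal (K0 * (1 / \<delta>\<^sub>0) powr (- 1 / s) * (\<Prod>k\<in>UNIV. \<delta> k powr (1 / s)))"
        using K0[of "1 / \<delta>\<^sub>0" \<delta> a c] \<delta>0 \<delta> unfolding W_def by simp
      also have "\<dots> \<le> ennreal L"
      proof (rule ennreal_leI)
        have "(1 / \<delta>\<^sub>0) powr (- 1 / s) = \<delta>\<^sub>0 powr (1 / s)"
          using \<delta>0 by (simp add: powr_divide powr_minus)
        moreover have "(\<Prod>k\<in>UNIV. \<delta> k powr (1 / s)) = (\<Prod>k\<in>UNIV. \<delta> k) powr (1 / s)"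
          using \<delta> by (simp add: prod_powr_distrib less_imp_le)
        ultimately have "(1 / \<delta>\<^sub>0) powr (- 1 / s) * (\<Prod>k\<in>UNIV. \<delta> k powr (1 / s)) = \<Delta> powr (1 / s)"
          unfolding \<Delta>_def using \<delta>0 \<delta> by (simp add: powr_mult prod_nonneg less_imp_le)
        then show "K0 * (1 / \<delta>\<^sub>0) powr (- 1 / s) * (\<Prod>k\<in>UNIV. \<delta> k powr (1 / s)) \<le> L"
          unfolding L_def K_def by (simp add: mult.assoc mult_right_mono)
      qed
      finally show ?thesis .
    qed
    have moment: "(\<integral>\<^sup>+t. ennreal (W t * g t powr p) \<partial>lborel) \<le> ennreal n"
    proof -
      have "ennreal (W t * g t powr p) = ennreal (1 / \<delta>\<^sub>0) * ennreal (g t powr p) +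
        (\<Sum>k\<in>UNIV. ennreal (1 / \<delta> k) * (ennreal \<bar>?w k t\<bar> * ennreal (g t powr p)))" for t
      proof -
        have "W t * g t powr p = 1 / \<delta>\<^sub>0 * g t powr p + (\<Sum>k\<in>UNIV. 1 / \<delta> k * (\<bar>?w k t\<bar> * g t powr p))"
          unfolding W_def by (simp add: distrib_right sum_distrib_right)
        also have "ennreal \<dots> = ennreal (1 / \<delta>\<^sub>0 * g t powr p) + (\<Sum>k\<in>UNIV. ennreal (1 / \<delta> k * (\<bar>?w k t\<bar> * g t powr p)))"
          using \<delta>0 \<delta>[THEN less_imp_le] by (subst ennreal_plus) (simp_all add: sum_nonneg sum_ennreal)
        also have "\<dots> = ennreal (1 / \<delta>\<^sub>0) * ennreal (g t powr p) +
          (\<Sum>k\<in>UNIV. ennreal (1 / \<delta> k) * (ennreal \<bar>?w k t\<bar> * ennreal (g t powr p)))"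
          using \<delta>0 \<delta>[THEN less_imp_le] by (simp only: ennreal_mult abs_ge_zero powr_ge_zero
            mult_nonneg_nonneg zero_le_divide_1_iff less_imp_le)
        finally show ?thesis .
      qed
      then have "(\<integral>\<^sup>+t. ennreal (W t * g t powr p) \<partial>lborel) =
        ennreal (1 / \<delta>\<^sub>0) * (\<integral>\<^sup>+t. ennreal (g t powr p) \<partial>lborel) +
        (\<Sum>k\<in>UNIV. ennreal (1 / \<delta> k) * (\<integral>\<^sup>+t. ennreal \<bar>?w k t\<bar> * ennreal (g t powr p) \<partial>lborel))"
        by (simp add: nn_integral_add nn_integral_sum nn_integral_cmult)
      also have "\<dots> \<le> ennreal (1 / \<delta>\<^sub>0) * ennreal \<delta>\<^sub>0 + (\<Sum>k\<in>UNIV. ennreal (1 / \<delta> k) * ennreal (\<delta> k))"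
        by (intro add_mono sum_mono mult_left_mono m0 m) simp_all
      also have "\<dots> = 1 + (\<Sum>k\<in>(UNIV :: 'n set). 1)"
      proof -
        have "ennreal (1 / x) * ennreal x = 1" if "x > 0" for x
          using that by (simp flip: ennreal_mult)
        then show ?thesis using \<delta>0 \<delta> by simp
      qed
      also have "\<dots> = ennreal n"
        unfolding n_def by (simp add: ennreal_of_nat_eq_real_of_nat add.commute)
      finally show ?thesis .
    qed
    \<comment> \<open>This choice balances the two coefficients:
      \<open>\<theta> * L = \<theta> powr (1 - p) = E\<close>.\<close>
    define \<theta> where "\<theta> = L powr (- (1 / p))"
    have \<theta>: "\<theta> > 0" using L by (simp add: \<theta>_def)
    define E where "E = L powr (s / (n + s))"
    have E0: "E \<ge> 0" by (simp add: E_def)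
    have E1: "\<theta> * L = E"
    proof -
      have "- (1 / p) + 1 = s / (n + s)"
        using n s unfolding p' by (simp add: field_simps)
      then show ?thesis
        using L powr_add[of L "- (1 / p)" 1] by (simp add: \<theta>_def E_def)
    qed
    have E2: "\<theta> powr (1 - p) = E"
    proof -
      have "- (1 / p) * (1 - p) = s / (n + s)"
        using n s unfolding p' by (simp add: field_simps)
      then show ?thesis by (simp add: \<theta>_def E_def powr_powr)
    qed
    have "(\<integral>\<^sup>+t. ennreal (g t) \<partial>lborel)
      \<le> (\<integral>\<^sup>+t. ennreal \<theta> * ennreal (W t powr (- (n / s))) + ennreal (\<theta> powr (1 - p)) * ennreal (W t * g t powr p) \<partial>lborel)"
    proof (rule nn_integral_mono)
      fix t
      have "g t \<le> \<theta> * W t powr (- (n / s)) + \<theta> powr (1 - p) * (W t * g t powr p)"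
        by (rule le_weighted_split) (use g0 W \<theta> p1 n s in \<open>auto simp: p' field_simps\<close>)
      then show "ennreal (g t) \<le> ennreal \<theta> * ennreal (W t powr (- (n / s))) + ennreal (\<theta> powr (1 - p)) * ennreal (W t * g t powr p)"
        using \<theta> W[of t] by (simp add: ennreal_leI flip: ennreal_mult ennreal_plus)
    qed
    also have "\<dots> = ennreal \<theta> * (\<integral>\<^sup>+t. ennreal (W t powr (- (n / s))) \<partial>lborel)
      + ennreal (\<theta> powr (1 - p)) * (\<integral>\<^sup>+t. ennreal (W t * g t powr p) \<partial>lborel)"
      by (simp add: nn_integral_add nn_integral_cmult)
    also have "\<dots> \<le> ennreal \<theta> * ennreal L + ennreal (\<theta> powr (1 - p)) * ennreal n"
      by (intro add_mono mult_left_mono kernel moment) simp_all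
    also have "\<dots> = ennreal ((n + 1) * E)"
      using \<theta> L n E1 E2 E0 by (simp add: algebra_simps flip: ennreal_mult ennreal_plus)
    finally have "(\<integral>\<^sup>+t. ennreal (g t) \<partial>lborel) ^ (CARD('n) + 1 + \<sigma>) \<le> ennreal ((n + 1) * E) ^ (CARD('n) + 1 + \<sigma>)"
      by (rule power_mono) simp
    also have "\<dots> = ennreal (((n + 1) * E) ^ (CARD('n) + 1 + \<sigma>))"
      using n E0 by (intro ennreal_power) simp
    \<comment> \<open>The exponent on the left is \<open>n + s\<close>, and
      \<open>E powr (n + s) = L powr s\<close>, in which \<open>\<Delta>\<close> occurs to the first
      power.\<close>
    also have "((n + 1) * E) ^ (CARD('n) + 1 + \<sigma>) = (n + 1) ^ (CARD('n) + 1 + \<sigma>) * K powr s * (\<delta>\<^sub>0 * (\<Prod>k\<in>UNIV. \<delta> k))"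
    proof -
      have "E ^ (CARD('n) + 1 + \<sigma>) = E powr (n + s)"
        using L by (subst powr_realpow[symmetric]) (simp_all add: E_def n_def s_def add_ac)
      also have "\<dots> = L powr s"
        using n s by (simp add: E_def powr_powr)
      also have "\<dots> = K powr s * \<Delta>"
        using K \<Delta> s by (simp add: L_def powr_mult powr_powr)
      finally show ?thesis by (simp only: power_mult_distrib \<Delta>_def mult.assoc)
    qed
    finally show "(\<integral>\<^sup>+t. ennreal (g t) \<partial>lborel) ^ (CARD('n) + 1 + \<sigma>)
      \<le> ennreal ((n + 1) ^ (CARD('n) + 1 + \<sigma>) * K powr s * (\<delta>\<^sub>0 * (\<Prod>k\<in>UNIV. \<delta> k)))" .
  qed
qed

text \<open>Boundedness and compact support make all moments finite, so the infima
  \<open>d k\<close> can be treated as reals. Adding \<open>\<epsilon>\<close> provides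
  near-minimisers and positive bounds even if an infimum is 0; after \<open>\<epsilon>\<close> tends
  to 0, the product of the infima is compared with the determinant integral.\<close>

lemma nn_integral_power_le_det_integral_bounded:
  fixes \<alpha> :: "'n::{finite,wellorder} \<Rightarrow> (nat, 'n) vec" and g :: "(real, 'n) vec \<Rightarrow> real"
  assumes C: "C \<ge> 0" and moments: "\<And>\<delta>\<^sub>0 (\<delta> :: 'n \<Rightarrow> real) (a :: 'n \<Rightarrow> real) (c :: 'n \<Rightarrow> 'n \<Rightarrow> real).
      0 < \<delta>\<^sub>0 \<Longrightarrow> (\<And>k. 0 < \<delta> k) \<Longrightarrow>
      (\<integral>\<^sup>+t. ennreal (g t powr p) \<partial>lborel) \<le> ennreal \<delta>\<^sub>0 \<Longrightarrow>
      (\<And>k. (\<integral>\<^sup>+t. ennreal \<bar>multi_power t (\<alpha> k) + (a k + (\<Sum>j\<in>{..<k}. c k j * multi_power t (\<alpha> j)))\<bar>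
          * ennreal (g t powr p) \<partial>lborel) \<le> ennreal (\<delta> k)) \<Longrightarrow>
      (\<integral>\<^sup>+t. ennreal (g t) \<partial>lborel) ^ N \<le> ennreal (C * (\<delta>\<^sub>0 * (\<Prod>k\<in>UNIV. \<delta> k)))"
    and p: "0 \<le> p"
    and g [measurable]: "g \<in> borel_measurable borel" and g0: "\<And>t. 0 \<le> g t" and gm: "\<And>t. g t \<le> m"
    and supp: "\<And>t. t \<notin> cball 0 r \<Longrightarrow> g t = 0"
  shows "(\<integral>\<^sup>+t. ennreal (g t) \<partial>lborel) ^ N \<le> ennreal C *
    (\<integral>\<^sup>+t\<^sub>0. ennreal (g t\<^sub>0 powr p) * (\<integral>\<^sup>+T.
      ennreal \<bar>det (sample_matrix (\<lambda>k t. multi_power t (\<alpha> k) - multi_power t\<^sub>0 (\<alpha> k)) UNIV T)\<bar> *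
      (\<Prod>k\<in>UNIV. ennreal (g (T k) powr p)) \<partial>PiM UNIV (\<lambda>_. lborel)) \<partial>lborel)"
proof -
  let ?P = "\<lambda>k t. multi_power t (\<alpha> k)"
  define h where "h t = ennreal (g t powr p)" for t
  have h [measurable]: "h \<in> borel_measurable borel" unfolding h_def by measurable
  define I where "I k a c = (\<integral>\<^sup>+t. ennreal \<bar>?P k t + (a + (\<Sum>j\<in>{..<k}. c j * ?P j t))\<bar> * h t \<partial>lborel)"
    for k :: 'n and a :: real and c :: "'n \<Rightarrow> real"
  define d where "d k = (INF ac. I k (fst ac) (snd ac))" for k
  define d\<^sub>0 where "d\<^sub>0 = (\<integral>\<^sup>+t. h t \<partial>lborel)"
  have finite_moment: "(\<integral>\<^sup>+t. ennreal \<bar>\<phi> t\<bar> * h t \<partial>lborel) < \<infinity>" if \<phi>: "continuous_on UNIV \<phi>" for \<phi> :: "(real, 'n) vec \<Rightarrow> real"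
  proof -
    have "compact (\<phi> ` cball 0 r)"
      by (intro compact_continuous_image continuous_on_subset[OF \<phi>]) auto
    then obtain B where "\<forall>t\<in>cball 0 r. \<bar>\<phi> t\<bar> \<le> B"
      using compact_imp_bounded[of "\<phi> ` cball 0 r"] unfolding bounded_real by auto
    then have B: "\<And>t. t \<in> cball 0 r \<Longrightarrow> \<bar>\<phi> t\<bar> \<le> B"
      by blast
    have "(\<integral>\<^sup>+t. ennreal \<bar>\<phi> t\<bar> * h t \<partial>lborel) \<le> (\<integral>\<^sup>+t. ennreal (B * m powr p) * indicator (cball 0 r) t \<partial>(lborel :: (real, 'n) vec measure))"
    proof (rule nn_integral_mono)
      fix t
      show "ennreal \<bar>\<phi> t\<bar> * h t \<le> ennreal (B * m powr p) * indicator (cball 0 r) t"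
      proof (cases "t \<in> cball 0 r")
        case True
        have "\<bar>\<phi> t\<bar> * g t powr p \<le> B * m powr p"
          by (intro mult_mono powr_mono2 B True gm g0 p) (use B[OF True] in auto)
        then show ?thesis
          using True by (simp add: h_def ennreal_leI flip: ennreal_mult)
      qed (simp add: h_def supp)
    qed
    also have "\<dots> = ennreal (B * m powr p) * emeasure lborel (cball (0 :: (real, 'n) vec) r)"
      by (rule nn_integral_cmult_indicator) simp
    also have "\<dots> < \<infinity>"
      using emeasure_lborel_cball_finite[of "0 :: (real, 'n) vec" r] by (simp add: ennreal_mult_less_top)
    finally show ?thesis .
  qed
  have d0_fin: "d\<^sub>0 < \<infinity>"
    using finite_moment[of "\<lambda>_. 1"] by (simp add: d\<^sub>0_def)
  have d_fin: "d k < \<infinity>" for k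
  proof -
    have "d k \<le> I k 0 (\<lambda>_. 0)"
      unfolding d_def by (rule INF_lower2[of "(0, \<lambda>_. 0)"]) auto
    also have "\<dots> < \<infinity>"
      using finite_moment[of "?P k"] unfolding I_def multi_power_def
      by (simp add: continuous_intros)
    finally show ?thesis .
  qed
  define G where "G = (\<integral>\<^sup>+t. ennreal (g t) \<partial>lborel) ^ N"
  have approx: "G \<le> ennreal (C * ((enn2real d\<^sub>0 + \<epsilon>) * (\<Prod>k\<in>UNIV. enn2real (d k) + \<epsilon>)))" if \<epsilon>: "\<epsilon> > 0" for \<epsilon>
  proof -
    have "\<exists>ac. I k (fst ac) (snd ac) \<le> ennreal (enn2real (d k) + \<epsilon>)" for k
    proof -
      have "d k = ennreal (enn2real (d k))" using d_fin[of k] by simp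
      also have "\<dots> < ennreal (enn2real (d k) + \<epsilon>)"
        using \<epsilon> by (intro ennreal_lessI) (auto intro: add_nonneg_pos)
      finally show ?thesis
        unfolding d_def INF_less_iff by (auto intro: less_imp_le)
    qed
    then obtain ac where ac: "\<And>k. I k (fst (ac k)) (snd (ac k)) \<le> ennreal (enn2real (d k) + \<epsilon>)"
      by metis
    show ?thesis
      unfolding G_def
    proof (rule moments[of _ _ "\<lambda>k. fst (ac k)" "\<lambda>k. snd (ac k)"])
      show "(\<integral>\<^sup>+t. ennreal (g t powr p) \<partial>lborel) \<le> ennreal (enn2real d\<^sub>0 + \<epsilon>)"
        using d0_fin \<epsilon> unfolding d\<^sub>0_def h_def[symmetric] by (simp add: ennreal_plus add_increasing2)
    qed (use \<epsilon> ac in \<open>auto simp: I_def h_def intro: add_nonneg_pos\<close>)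
  qed
  \<comment> \<open>Finiteness of \<open>G\<close> allows the limit in \<open>\<epsilon>\<close> to
    be taken among reals.\<close>
  have "G < \<infinity>"
    using approx[of 1] by (simp add: less_top[symmetric] top_unique) (metis ennreal_less_top le_less_trans infinity_ennreal_def less_irrefl)
  then obtain G' where G': "G = ennreal G'" "G' \<ge> 0"
    by (cases G) auto
  have nonneg: "0 \<le> C * ((enn2real d\<^sub>0 + \<epsilon>) * (\<Prod>k\<in>UNIV. enn2real (d k) + \<epsilon>))" if "\<epsilon> > 0" for \<epsilon>
    using C that by (intro mult_nonneg_nonneg prod_nonneg) auto
  have "G' \<le> C * ((enn2real d\<^sub>0 + 0) * (\<Prod>k\<in>UNIV. enn2real (d k) + 0))"
  proof (rule tendsto_lowerbound)
    show "((\<lambda>\<epsilon>. C * ((enn2real d\<^sub>0 + \<epsilon>) * (\<Prod>k\<in>UNIV. enn2real (d k) + \<epsilon>))) \<longlongrightarrow>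
      C * ((enn2real d\<^sub>0 + 0) * (\<Prod>k\<in>UNIV. enn2real (d k) + 0))) (at_right 0)"
      by (intro tendsto_intros)
    show "\<forall>\<^sub>F \<epsilon> in at_right 0. G' \<le> C * ((enn2real d\<^sub>0 + \<epsilon>) * (\<Prod>k\<in>UNIV. enn2real (d k) + \<epsilon>))"
      using eventually_at_right_less[of 0]
    proof eventually_elim
      case (elim \<epsilon>)
      then show ?case
        using approx[of \<epsilon>] nonneg[of \<epsilon>] G' by simp
    qed
  qed simp
  then have "G \<le> ennreal (C * (enn2real d\<^sub>0 * (\<Prod>k\<in>UNIV. enn2real (d k))))"
    unfolding G' by (simp add: ennreal_leI)
  also have "\<dots> = ennreal C * (d\<^sub>0 * (\<Prod>k\<in>UNIV. d k))"
    using C d0_fin d_fin by (simp add: ennreal_mult prod_nonneg flip: prod_ennreal)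
  also have "d\<^sub>0 * (\<Prod>k\<in>UNIV. d k) = (\<integral>\<^sup>+t\<^sub>0. h t\<^sub>0 * (\<Prod>k\<in>UNIV. d k) \<partial>lborel)"
    unfolding d\<^sub>0_def by (rule nn_integral_multc[symmetric]) simp
  \<comment> \<open>The determinant bound holds for every base point, with \<open>u k\<close> the
    value of the monomial there; one bound serves all base points because \<open>d k\<close> is an
    infimum over all constants.\<close>
  also have "\<dots> \<le> (\<integral>\<^sup>+t\<^sub>0. h t\<^sub>0 * (\<integral>\<^sup>+T. ennreal \<bar>det (sample_matrix (\<lambda>k t. ?P k t - ?P k t\<^sub>0) UNIV T)\<bar> *
      (\<Prod>k\<in>UNIV. h (T k)) \<partial>PiM UNIV (\<lambda>_. lborel)) \<partial>lborel)"
  proof (intro nn_integral_mono mult_left_mono)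
    fix t\<^sub>0 :: "(real, 'n) vec"
    have le: "d k \<le> I k a c" for k a c
      unfolding d_def by (rule INF_lower2[of "(a, c)"]) auto
    show "(\<Prod>k\<in>UNIV. d k) \<le> (\<integral>\<^sup>+T. ennreal \<bar>det (sample_matrix (\<lambda>k t. ?P k t - ?P k t\<^sub>0) UNIV T)\<bar> *
      (\<Prod>k\<in>UNIV. h (T k)) \<partial>PiM UNIV (\<lambda>_. lborel))"
      by (rule prod_le_nn_integral_det) (use le in \<open>auto simp: I_def intro: lborel.sigma_finite_measure_axioms\<close>)
  qed simp
  finally show ?thesis
    unfolding G_def h_def by (simp add: mult_left_mono)
qed

text \<open>For finite \<open>R\<close> the \<open>N\<close>-th root of \<open>R\<close> bounds
  every \<open>x m\<close>. This passes the inequality from truncations to their limit.\<close>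

lemma SUP_power_le_ennreal:
  fixes x :: "'i \<Rightarrow> ennreal"
  assumes N: "0 < N" and le: "\<And>m. x m ^ N \<le> R"
  shows "(SUP m. x m) ^ N \<le> R"
proof (cases R)
  case (real R')
  have "x m \<le> ennreal (root N R')" for m
  proof (cases "x m")
    case (real y)
    then have "ennreal (y ^ N) \<le> ennreal R'"
      using le[of m] \<open>R = ennreal R'\<close> by (simp add: ennreal_power)
    then have "y ^ N \<le> root N R' ^ N"
      using \<open>0 \<le> R'\<close> real N by simp
    then have "y \<le> root N R'"
      by (rule power_mono_iff[THEN iffD1, rotated 3]) (use \<open>0 \<le> R'\<close> real N in auto)
    then show ?thesis using real by (simp add: ennreal_leI)
  next
    case top
    then show ?thesis
      using le[of m] N \<open>R = ennreal R'\<close> by (simp add: power_eq_top_ennreal top_unique)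
  qed
  then have "(SUP m. x m) ^ N \<le> ennreal (root N R') ^ N"
    by (intro power_mono SUP_least) auto
  also have "\<dots> = R"
    using real N by (simp add: ennreal_power)
  finally show ?thesis .
qed simp

text \<open>\<open>g\<close> is truncated in height and to balls. The constant does not depend on
  the truncation, the right-hand side is monotone in \<open>g\<close>, and monotone convergence
  treats the left-hand side.\<close>

lemma nn_integral_power_le_det_integral:
  fixes \<alpha> :: "'n::{finite,wellorder} \<Rightarrow> (nat, 'n) vec"
  assumes det: "det (exponent_matrix \<alpha>) \<noteq> 0"
    and sum: "\<And>i. (\<Sum>k\<in>UNIV. \<alpha> k $ i) = \<sigma>" and \<sigma>: "0 < \<sigma>"
    and p: "p = (real CARD('n) + 1 + real \<sigma>) / (real CARD('n) + 1)"
  obtains C :: real where "C \<ge> 0"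
    "\<And>g :: (real, 'n) vec \<Rightarrow> real. g \<in> borel_measurable borel \<Longrightarrow> (\<And>t. 0 \<le> g t) \<Longrightarrow>
    (\<integral>\<^sup>+t. ennreal (g t) \<partial>lborel) ^ (CARD('n) + 1 + \<sigma>) \<le> ennreal C *
    (\<integral>\<^sup>+t\<^sub>0. ennreal (g t\<^sub>0 powr p) * (\<integral>\<^sup>+T.
      ennreal \<bar>det (sample_matrix (\<lambda>k t. multi_power t (\<alpha> k) - multi_power t\<^sub>0 (\<alpha> k)) UNIV T)\<bar> *
      (\<Prod>k\<in>UNIV. ennreal (g (T k) powr p)) \<partial>PiM UNIV (\<lambda>_. lborel)) \<partial>lborel)"
proof -
  define N where "N = CARD('n) + 1 + \<sigma>"
  have N: "N > 0" by (simp add: N_def)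
  have p0: "p \<ge> 0" using p by simp
  obtain C :: real where C: "C \<ge> 0" and moments:
    "\<And>(g :: (real, 'n) vec \<Rightarrow> real) \<delta>\<^sub>0 (\<delta> :: 'n \<Rightarrow> real) (a :: 'n \<Rightarrow> real) (c :: 'n \<Rightarrow> 'n \<Rightarrow> real).
      g \<in> borel_measurable borel \<Longrightarrow> (\<And>t. 0 \<le> g t) \<Longrightarrow> 0 < \<delta>\<^sub>0 \<Longrightarrow> (\<And>k. 0 < \<delta> k) \<Longrightarrow>
      (\<integral>\<^sup>+t. ennreal (g t powr p) \<partial>lborel) \<le> ennreal \<delta>\<^sub>0 \<Longrightarrow>
      (\<And>k. (\<integral>\<^sup>+t. ennreal \<bar>multi_power t (\<alpha> k) + (a k + (\<Sum>j\<in>{..<k}. c k j * multi_power t (\<alpha> j)))\<bar>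
          * ennreal (g t powr p) \<partial>lborel) \<le> ennreal (\<delta> k)) \<Longrightarrow>
      (\<integral>\<^sup>+t. ennreal (g t) \<partial>lborel) ^ N \<le> ennreal (C * (\<delta>\<^sub>0 * (\<Prod>k\<in>UNIV. \<delta> k)))"
    using nn_integral_power_le_moments[OF det sum \<sigma> p] unfolding N_def by blast
  show thesis
  proof (rule that[OF C], fold N_def)
    fix g :: "(real, 'n) vec \<Rightarrow> real"
    assume g [measurable]: "g \<in> borel_measurable borel" and g0: "\<And>t. 0 \<le> g t"
    let ?R = "\<lambda>g. ennreal C * (\<integral>\<^sup>+t\<^sub>0. ennreal (g t\<^sub>0 powr p) * (\<integral>\<^sup>+T.
      ennreal \<bar>det (sample_matrix (\<lambda>k t. multi_power t (\<alpha> k) - multi_power t\<^sub>0 (\<alpha> k)) UNIV T)\<bar> *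
      (\<Prod>k\<in>UNIV. ennreal (g (T k) powr p)) \<partial>PiM UNIV (\<lambda>_. lborel)) \<partial>lborel)"
    define u where "u m t = min (g t) (real m) * indicator (cball 0 (real m)) t" for m t
    have [measurable]: "cball (0 :: (real, 'n) vec) (real m) \<in> sets borel" for m
      by (simp add: borel_closed)
    have u_meas [measurable]: "u m \<in> borel_measurable borel" for m
      unfolding u_def by measurable
    have u0: "0 \<le> u m t" and u_le: "u m t \<le> g t" for m t
      using g0[of t] by (auto simp: u_def indicator_def)
    have bound: "(\<integral>\<^sup>+t. ennreal (u m t) \<partial>lborel) ^ N \<le> ?R g" for m
    proof -
      have "(\<integral>\<^sup>+t. ennreal (u m t) \<partial>lborel) ^ N \<le> ?R (u m)"
      proof (rule nn_integral_power_le_det_integral_bounded[OF C _ p0 u_meas u0])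
        show "u m t \<le> real m" for t by (simp add: u_def indicator_def)
        show "u m t = 0" if "t \<notin> cball 0 (real m)" for t using that by (simp add: u_def)
      qed (rule moments[OF u_meas u0])
      also have "\<dots> \<le> ?R g"
        by (intro mult_left_mono nn_integral_mono mult_mono prod_mono_ennreal ennreal_leI powr_mono2 u_le u0 p0 order_refl) auto
      finally show ?thesis .
    qed
    have sup: "(SUP m. ennreal (u m t)) = ennreal (g t)" for t
    proof (rule antisym)
      show "(SUP m. ennreal (u m t)) \<le> ennreal (g t)"
        by (intro SUP_least ennreal_leI u_le)
      obtain m :: nat where "max (g t) (norm t) \<le> real m"
        using real_arch_simple by blast
      then have "u m t = g t" by (simp add: u_def indicator_def)
      then show "ennreal (g t) \<le> (SUP m. ennreal (u m t))"
        by (metis SUP_upper UNIV_I)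
    qed
    have inc: "incseq (\<lambda>m t. ennreal (u m t))"
    proof (rule incseq_SucI, rule le_funI)
      fix m t
      show "ennreal (u m t) \<le> ennreal (u (Suc m) t)"
        using g0[of t] by (intro ennreal_leI) (auto simp: u_def indicator_def)
    qed
    have "(\<integral>\<^sup>+t. ennreal (g t) \<partial>lborel) = (SUP m. \<integral>\<^sup>+t. ennreal (u m t) \<partial>lborel)"
      unfolding sup[symmetric] by (rule nn_integral_monotone_convergence_SUP[OF inc]) simp
    then show "(\<integral>\<^sup>+t. ennreal (g t) \<partial>lborel) ^ N \<le> ?R g"
      using SUP_power_le_ennreal[OF N bound] by simp
  qed
qed

section \<open>Integration over the family of hypersurfaces\<close>

text \<open>The substitution \<open>z = A *v v\<close> has Jacobian \<open>\<bar>det A\<bar>\<close>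
  and leaves a product of functions of single coordinates. For singular \<open>A\<close> the
  left-hand side is 0, even if the integral is infinite.\<close>

lemma det_times_nn_integral_linear_le:
  fixes A :: "((real, 'n::{finite,wellorder}) vec, 'n) vec" and F :: "'n \<Rightarrow> real \<Rightarrow> real"
  assumes F [measurable]: "\<And>k. F k \<in> borel_measurable borel" and F0: "\<And>k s. 0 \<le> F k s"
  shows "ennreal \<bar>det A\<bar> * (\<integral>\<^sup>+v. (\<Prod>k\<in>UNIV. ennreal (F k ((A *v v) $ k))) \<partial>lborel)
    \<le> (\<Prod>k\<in>UNIV. \<integral>\<^sup>+s. ennreal (F k s) \<partial>lborel)"
proof (cases "det A = 0")
  case False
  define f where "f z = (\<Prod>k\<in>UNIV. F k (z $ k))" for z :: "(real, 'n) vec"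
  have [measurable]: "f \<in> borel_measurable borel" unfolding f_def by measurable
  have [measurable]: "(*v) A \<in> borel_measurable borel"
    by (intro borel_measurable_continuous_onI linear_continuous_on) (simp add: linear_linear)
  have f0: "0 \<le> f z" for z
    unfolding f_def by (intro prod_nonneg) (simp add: F0)
  have inj: "inj ((*v) A)"
    using False by (simp add: invertible_det_nz[symmetric] inj_matrix_vector_mult)
  have "ennreal \<bar>det A\<bar> * (\<integral>\<^sup>+v. (\<Prod>k\<in>UNIV. ennreal (F k ((A *v v) $ k))) \<partial>lborel)
    = ennreal \<bar>det A\<bar> * (\<integral>\<^sup>+v. ennreal (f (A *v v)) \<partial>lborel)"
    by (simp add: f_def prod_ennreal F0)
  also have "\<dots> = (\<integral>\<^sup>+v. ennreal (\<bar>det (matrix ((*v) A))\<bar> * f (A *v v)) * indicator UNIV v \<partial>lborel)"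
    by (subst nn_integral_cmult[symmetric]) (simp_all add: ennreal_mult f0)
  also have "\<dots> \<le> (\<integral>\<^sup>+z. ennreal (f z) \<partial>lborel)"
    by (rule nn_integral_change_of_variables_le)
      (use f0 inj in \<open>auto intro: linear_imp_has_derivative simp: linear_linear\<close>)
  also have "\<dots> = (\<integral>\<^sup>+x. (\<Prod>k\<in>UNIV. ennreal (F k (x k))) \<partial>PiM UNIV (\<lambda>_. lborel))"
    by (subst nn_integral_vec) (simp_all add: f_def prod_ennreal F0)
  also have "\<dots> = (\<Prod>k\<in>UNIV. \<integral>\<^sup>+s. ennreal (F k s) \<partial>lborel)"
  proof -
    interpret product_sigma_finite "\<lambda>_::'n. lborel :: real measure" by standard
    show ?thesis by (rule product_nn_integral_prod) auto
  qed
  finally show ?thesis .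
qed simp

text \<open>A translation in \<open>y\<^sub>0\<close> and a linear change of variables in \<open>v\<close> turn the values at
  the \<open>n + 1\<close> sample points into independent variables.\<close>

lemma nn_integral_det_samples_le:
  fixes P :: "'n::{finite,wellorder} \<Rightarrow> (real, 'n) vec \<Rightarrow> real" and F :: "(real, 'n) vec \<times> real \<Rightarrow> real"
  assumes F [measurable]: "F \<in> borel_measurable borel" and F0: "\<And>x. 0 \<le> F x"
  shows "(\<integral>\<^sup>+v. \<integral>\<^sup>+y\<^sub>0. ennreal (F (t\<^sub>0, y\<^sub>0 + (\<Sum>j\<in>UNIV. v $ j * P j t\<^sub>0))) *
      (ennreal \<bar>det (sample_matrix (\<lambda>k t. P k t - P k t\<^sub>0) UNIV T)\<bar> *
      (\<Prod>k\<in>UNIV. ennreal (F (T k, y\<^sub>0 + (\<Sum>j\<in>UNIV. v $ j * P j (T k)))))) \<partial>lborel \<partial>lborel)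
    \<le> (\<integral>\<^sup>+s. ennreal (F (t\<^sub>0, s)) \<partial>lborel) * (\<Prod>k\<in>UNIV. \<integral>\<^sup>+s. ennreal (F (T k, s)) \<partial>lborel)"
proof -
  define A where "A = sample_matrix (\<lambda>k t. P k t - P k t\<^sub>0) UNIV T"
  have F' [measurable]: "(\<lambda>s. F (t, s)) \<in> borel_measurable borel" for t
    using F by (simp add: borel_prod[symmetric])
  let ?H = "\<lambda>v s. ennreal (F (t\<^sub>0, s)) * (ennreal \<bar>det A\<bar> * (\<Prod>k\<in>UNIV. ennreal (F (T k, s + (A *v v) $ k))))"
  have [measurable]: "(\<lambda>v. (A *v v) $ k) \<in> borel_measurable borel" for k
    unfolding matrix_vector_mult_def by simp
  have [measurable]: "(\<lambda>(v, s). ?H v s) \<in> borel_measurable (lborel \<Otimes>\<^sub>M lborel)"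
    by measurable
  have "(\<integral>\<^sup>+v. \<integral>\<^sup>+y\<^sub>0. ennreal (F (t\<^sub>0, y\<^sub>0 + (\<Sum>j\<in>UNIV. v $ j * P j t\<^sub>0))) *
      (ennreal \<bar>det A\<bar> * (\<Prod>k\<in>UNIV. ennreal (F (T k, y\<^sub>0 + (\<Sum>j\<in>UNIV. v $ j * P j (T k)))))) \<partial>lborel \<partial>lborel)
    = (\<integral>\<^sup>+v. \<integral>\<^sup>+s. ?H v s \<partial>lborel \<partial>lborel)"
  proof (rule nn_integral_cong)
    fix v :: "(real, 'n) vec"
    \<comment> \<open>The new variable \<open>s\<close> is the second argument of \<open>F\<close>
      at the base point. Relative to it, the argument at \<open>T k\<close> is offset by differences
      of the \<open>P j\<close>, which form row \<open>k\<close> of \<open>A\<close>.\<close>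
    have shift: "- (\<Sum>j\<in>UNIV. v $ j * P j t\<^sub>0) + 1 * s + (\<Sum>j\<in>UNIV. v $ j * P j (T k)) = s + (A *v v) $ k" for s k
      by (simp add: A_def sample_matrix_def matrix_vector_mult_def right_diff_distrib sum_subtractf mult.commute)
    show "(\<integral>\<^sup>+y\<^sub>0. ennreal (F (t\<^sub>0, y\<^sub>0 + (\<Sum>j\<in>UNIV. v $ j * P j t\<^sub>0))) *
      (ennreal \<bar>det A\<bar> * (\<Prod>k\<in>UNIV. ennreal (F (T k, y\<^sub>0 + (\<Sum>j\<in>UNIV. v $ j * P j (T k)))))) \<partial>lborel)
      = (\<integral>\<^sup>+s. ?H v s \<partial>lborel)"
      by (subst nn_integral_real_affine[where c = 1 and t = "- (\<Sum>j\<in>UNIV. v $ j * P j t\<^sub>0)"])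
        (simp_all only: shift, simp_all)
  qed
  also have "\<dots> = (\<integral>\<^sup>+s. \<integral>\<^sup>+v. ?H v s \<partial>lborel \<partial>lborel)"
    by (rule lborel_pair.Fubini'[symmetric]) measurable
  also have "\<dots> = (\<integral>\<^sup>+s. ennreal (F (t\<^sub>0, s)) * (ennreal \<bar>det A\<bar> *
      (\<integral>\<^sup>+v. (\<Prod>k\<in>UNIV. ennreal (F (T k, s + (A *v v) $ k))) \<partial>lborel)) \<partial>lborel)"
    by (simp add: nn_integral_cmult)
  also have "\<dots> \<le> (\<integral>\<^sup>+s. ennreal (F (t\<^sub>0, s)) * (\<Prod>k\<in>UNIV. \<integral>\<^sup>+z. ennreal (F (T k, z)) \<partial>lborel) \<partial>lborel)"
  proof (intro nn_integral_mono mult_left_mono)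
    fix s :: real
    have "ennreal \<bar>det A\<bar> * (\<integral>\<^sup>+v. (\<Prod>k\<in>UNIV. ennreal (F (T k, s + (A *v v) $ k))) \<partial>lborel)
      \<le> (\<Prod>k\<in>UNIV. \<integral>\<^sup>+z. ennreal (F (T k, s + z)) \<partial>lborel)"
      by (rule det_times_nn_integral_linear_le) (simp_all add: F0)
    also have "\<dots> = (\<Prod>k\<in>UNIV. \<integral>\<^sup>+z. ennreal (F (T k, z)) \<partial>lborel)"
      by (subst (2) nn_integral_real_affine[where c = 1 and t = s]) simp_all
    finally show "ennreal \<bar>det A\<bar> * (\<integral>\<^sup>+v. (\<Prod>k\<in>UNIV. ennreal (F (T k, s + (A *v v) $ k))) \<partial>lborel)
      \<le> (\<Prod>k\<in>UNIV. \<integral>\<^sup>+z. ennreal (F (T k, z)) \<partial>lborel)" .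
  qed simp
  also have "\<dots> = (\<integral>\<^sup>+s. ennreal (F (t\<^sub>0, s)) \<partial>lborel) * (\<Prod>k\<in>UNIV. \<integral>\<^sup>+s. ennreal (F (T k, s)) \<partial>lborel)"
    by (rule nn_integral_multc) simp
  finally show ?thesis unfolding A_def .
qed

text \<open>By Tonelli the parameter \<open>y\<close> is integrated first, with all sample points
  fixed. This leaves a product of \<open>CARD('n) + 1\<close> factors in separate sample points,
  each with integral equal to that of \<open>F\<close>.\<close>

lemma nn_integral_det_average_le:
  fixes P :: "'n::{finite,wellorder} \<Rightarrow> (real, 'n) vec \<Rightarrow> real" and F :: "(real, 'n) vec \<times> real \<Rightarrow> real"
  assumes P [measurable]: "\<And>k. P k \<in> borel_measurable borel"
    and F [measurable]: "F \<in> borel_measurable borel" and F0: "\<And>x. 0 \<le> F x"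
  defines "J \<equiv> (\<lambda>y. \<integral>\<^sup>+t\<^sub>0. ennreal (F (t\<^sub>0, fst y + (\<Sum>j\<in>UNIV. snd y $ j * P j t\<^sub>0))) *
      (\<integral>\<^sup>+T. ennreal \<bar>det (sample_matrix (\<lambda>k t. P k t - P k t\<^sub>0) UNIV T)\<bar> *
      (\<Prod>k\<in>UNIV. ennreal (F (T k, fst y + (\<Sum>j\<in>UNIV. snd y $ j * P j (T k))))) \<partial>PiM UNIV (\<lambda>_. lborel))
      \<partial>lborel)"
  shows "J \<in> borel_measurable borel"
    and "(\<integral>\<^sup>+y. J y \<partial>(lborel :: (real \<times> (real, 'n) vec) measure))
      \<le> (\<integral>\<^sup>+x. ennreal (F x) \<partial>lborel) ^ (CARD('n) + 1)"
proof -
  interpret PS: product_sigma_finite "\<lambda>_::'n. lborel :: (real, 'n) vec measure" by standard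
  interpret PU: sigma_finite_measure "PiM UNIV (\<lambda>_::'n. lborel :: (real, 'n) vec measure)"
    by (rule PS.sigma_finite) simp
  let ?M = "PiM UNIV (\<lambda>_::'n. lborel :: (real, 'n) vec measure)"
  \<comment> \<open>\<open>?Z\<close> collects the base point and the remaining sample points;
    \<open>?Y\<close> is the space of the parameters.\<close>
  let ?Z = "(lborel :: (real, 'n) vec measure) \<Otimes>\<^sub>M ?M"
  let ?Y = "(lborel :: real measure) \<Otimes>\<^sub>M (lborel :: (real, 'n) vec measure)"
  interpret Z: pair_sigma_finite "lborel :: (real, 'n) vec measure" ?M by standard
  interpret YZ: pair_sigma_finite ?Y ?Z
    by (intro pair_sigma_finite.intro lborel_pair.sigma_finite_measure_axioms Z.sigma_finite_measure_axioms)
  have [measurable]: "F \<in> borel_measurable (borel \<Otimes>\<^sub>M borel)"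
    using F by (simp add: borel_prod)
  define \<Phi> where "\<Phi> y z = ennreal (F (fst z, fst y + (\<Sum>j\<in>UNIV. snd y $ j * P j (fst z)))) *
      (ennreal \<bar>det (sample_matrix (\<lambda>k t. P k t - P k (fst z)) UNIV (snd z))\<bar> *
      (\<Prod>k\<in>UNIV. ennreal (F (snd z k, fst y + (\<Sum>j\<in>UNIV. snd y $ j * P j (snd z k))))))"
    for y :: "real \<times> (real, 'n) vec" and z :: "(real, 'n) vec \<times> ('n \<Rightarrow> (real, 'n) vec)"
  have [measurable]: "(\<lambda>z. snd z k) \<in> ?Z \<rightarrow>\<^sub>M borel" for k
    by measurable
  have [measurable]: "(\<lambda>z. det (sample_matrix (\<lambda>k t. P k t - P k (fst z)) UNIV (snd z))) \<in> borel_measurable ?Z"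
    by (rule measurable_det) (simp add: sample_matrix_def)
  have \<Phi> [measurable]: "(\<lambda>(y, z). \<Phi> y z) \<in> borel_measurable (?Y \<Otimes>\<^sub>M ?Z)"
    unfolding \<Phi>_def by measurable
  define \<phi> where "\<phi> t = (\<integral>\<^sup>+s. ennreal (F (t, s)) \<partial>lborel)" for t
  have [measurable]: "\<phi> \<in> borel_measurable borel"
    unfolding \<phi>_def by measurable
  have J: "J y = (\<integral>\<^sup>+z. \<Phi> y z \<partial>?Z)" for y
  proof -
    have "J y = (\<integral>\<^sup>+t\<^sub>0. \<integral>\<^sup>+T. \<Phi> y (t\<^sub>0, T) \<partial>?M \<partial>lborel)"
      unfolding J_def \<Phi>_def by (intro nn_integral_cong) (simp add: nn_integral_cmult)
    also have "\<dots> = (\<integral>\<^sup>+z. \<Phi> y z \<partial>?Z)"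
      by (rule PU.nn_integral_fst) (use measurable_Pair2[OF \<Phi>, of y] in \<open>simp add: space_pair_measure\<close>)
    finally show ?thesis .
  qed
  have "J \<in> borel_measurable ?Y"
    unfolding J[abs_def] by measurable
  then show "J \<in> borel_measurable borel"
    by (simp add: lborel_prod)
  have "(\<integral>\<^sup>+y. J y \<partial>lborel) = (\<integral>\<^sup>+y. \<integral>\<^sup>+z. \<Phi> y z \<partial>?Z \<partial>?Y)"
    unfolding J lborel_prod ..
  also have "\<dots> = (\<integral>\<^sup>+z. \<integral>\<^sup>+y. \<Phi> y z \<partial>?Y \<partial>?Z)"
    by (rule YZ.Fubini'[symmetric]) measurable
  also have "\<dots> = (\<integral>\<^sup>+z. \<integral>\<^sup>+v. \<integral>\<^sup>+y\<^sub>0. \<Phi> (y\<^sub>0, v) z \<partial>lborel \<partial>lborel \<partial>?Z)"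
    by (intro nn_integral_cong lborel_pair.nn_integral_snd[symmetric]) measurable
  also have "\<dots> \<le> (\<integral>\<^sup>+z. \<phi> (fst z) * (\<Prod>k\<in>UNIV. \<phi> (snd z k)) \<partial>?Z)"
    unfolding \<Phi>_def \<phi>_def fst_conv snd_conv
    by (intro nn_integral_mono nn_integral_det_samples_le F F0)
  also have "\<dots> = (\<integral>\<^sup>+t\<^sub>0. \<integral>\<^sup>+T. \<phi> t\<^sub>0 * (\<Prod>k\<in>UNIV. \<phi> (T k)) \<partial>?M \<partial>lborel)"
    by (subst PU.nn_integral_fst[symmetric]) simp_all
  also have "\<dots> = (\<integral>\<^sup>+t\<^sub>0. \<phi> t\<^sub>0 * (\<integral>\<^sup>+t. \<phi> t \<partial>lborel) ^ CARD('n) \<partial>lborel)"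
  proof (intro nn_integral_cong)
    fix t\<^sub>0 :: "(real, 'n) vec"
    have "(\<integral>\<^sup>+T. (\<Prod>k\<in>UNIV. \<phi> (T k)) \<partial>?M) = (\<Prod>k\<in>(UNIV :: 'n set). \<integral>\<^sup>+t. \<phi> t \<partial>lborel)"
      by (rule PS.product_nn_integral_prod) simp_all
    then show "(\<integral>\<^sup>+T. \<phi> t\<^sub>0 * (\<Prod>k\<in>UNIV. \<phi> (T k)) \<partial>?M) = \<phi> t\<^sub>0 * (\<integral>\<^sup>+t. \<phi> t \<partial>lborel) ^ CARD('n)"
      by (subst nn_integral_cmult) simp_all
  qed
  also have "\<dots> = (\<integral>\<^sup>+t. \<phi> t \<partial>lborel) ^ (CARD('n) + 1)"
    by (subst nn_integral_multc) simp_all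
  also have "(\<integral>\<^sup>+t. \<phi> t \<partial>lborel) = (\<integral>\<^sup>+x. ennreal (F x) \<partial>lborel)"
    unfolding \<phi>_def lborel_prod[symmetric] by (rule lborel.nn_integral_fst) simp
  finally show "(\<integral>\<^sup>+y. J y \<partial>lborel) \<le> (\<integral>\<^sup>+x. ennreal (F x) \<partial>lborel) ^ (CARD('n) + 1)" .
qed

section \<open>Arbitrary finite index types\<close>

lemma measurable_averaging_point [measurable (raw)]:
  assumes f: "f \<in> borel_measurable M" and [measurable]: "g \<in> borel_measurable M"
  shows "(\<lambda>x. averaging_point \<alpha> (f x) (g x)) \<in> borel_measurable M"
proof -
  have [measurable]: "f \<in> M \<rightarrow>\<^sub>M borel \<Otimes>\<^sub>M borel"
    using f by (simp add: borel_prod)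
  show ?thesis
    unfolding averaging_point_def borel_prod[symmetric] by measurable
qed

lemma measurable_nn_integral_averaging_point [measurable]:
  assumes [measurable]: "G \<in> borel_measurable borel"
  shows "(\<lambda>y. \<integral>\<^sup>+t. ennreal (G (averaging_point \<alpha> y t)) \<partial>lborel) \<in> borel_measurable borel"
  by measurable

text \<open>For the exponents of the theorem this is the norm inequality raised to the power
  \<open>q\<close>, as \<open>q / p = CARD('n) + 1\<close>. Non-negative integrals admit infinite
  averages, so no convergence has to be known beforehand.\<close>

definition averaging_bound :: "('n::finite \<Rightarrow> nat ^ 'n) \<Rightarrow> nat \<Rightarrow> real \<Rightarrow> real \<Rightarrow> bool" where
  "averaging_bound \<alpha> \<sigma> p C \<longleftrightarrow> (\<forall>G \<in> borel_measurable borel. (\<forall>x. 0 \<le> G x) \<longrightarrow>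
    (\<integral>\<^sup>+y. (\<integral>\<^sup>+t. ennreal (G (averaging_point \<alpha> y t)) \<partial>lborel) ^ (CARD('n) + 1 + \<sigma>) \<partial>lborel)
      \<le> ennreal C * (\<integral>\<^sup>+x. ennreal (G x powr p) \<partial>lborel) ^ (CARD('n) + 1))"

text \<open>The determinant inequality is applied to \<open>G\<close> along the hypersurface of each
  \<open>y\<close>; integrating its right-hand side over \<open>y\<close> is the preceding estimate
  with \<open>F = G powr p\<close>.\<close>

lemma averaging_bound_wellorder:
  fixes \<alpha> :: "'n::{finite,wellorder} \<Rightarrow> (nat, 'n) vec"
  assumes det: "det (exponent_matrix \<alpha>) \<noteq> 0"
    and sum: "\<And>i. (\<Sum>k\<in>UNIV. \<alpha> k $ i) = \<sigma>" and \<sigma>: "0 < \<sigma>"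
    and p: "p = (real CARD('n) + 1 + real \<sigma>) / (real CARD('n) + 1)"
  shows "\<exists>C\<ge>0. averaging_bound \<alpha> \<sigma> p C"
proof -
  obtain C :: real where C: "C \<ge> 0" and det_ineq:
    "\<And>g :: (real, 'n) vec \<Rightarrow> real. g \<in> borel_measurable borel \<Longrightarrow> (\<And>t. 0 \<le> g t) \<Longrightarrow>
    (\<integral>\<^sup>+t. ennreal (g t) \<partial>lborel) ^ (CARD('n) + 1 + \<sigma>) \<le> ennreal C *
    (\<integral>\<^sup>+t\<^sub>0. ennreal (g t\<^sub>0 powr p) * (\<integral>\<^sup>+T.
      ennreal \<bar>det (sample_matrix (\<lambda>k t. multi_power t (\<alpha> k) - multi_power t\<^sub>0 (\<alpha> k)) UNIV T)\<bar> *
      (\<Prod>k\<in>UNIV. ennreal (g (T k) powr p)) \<partial>PiM UNIV (\<lambda>_. lborel)) \<partial>lborel)"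
    using nn_integral_power_le_det_integral[OF det sum \<sigma> p] by blast
  have "averaging_bound \<alpha> \<sigma> p C"
    unfolding averaging_bound_def
  proof (intro ballI impI)
    fix G :: "(real, 'n) vec \<times> real \<Rightarrow> real"
    assume G [measurable]: "G \<in> borel_measurable borel" and "\<forall>x. 0 \<le> G x"
    then have G0: "0 \<le> G x" for x by blast
    let ?P = "\<lambda>k t. multi_power t (\<alpha> k)"
    define F where "F x = G x powr p" for x
    have F [measurable]: "F \<in> borel_measurable borel" unfolding F_def by measurable
    have F0: "0 \<le> F x" for x by (simp add: F_def)
    define J where "J y = (\<integral>\<^sup>+t\<^sub>0. ennreal (F (t\<^sub>0, fst y + (\<Sum>j\<in>UNIV. snd y $ j * ?P j t\<^sub>0))) *
      (\<integral>\<^sup>+T. ennreal \<bar>det (sample_matrix (\<lambda>k t. ?P k t - ?P k t\<^sub>0) UNIV T)\<bar> *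
      (\<Prod>k\<in>UNIV. ennreal (F (T k, fst y + (\<Sum>j\<in>UNIV. snd y $ j * ?P j (T k))))) \<partial>PiM UNIV (\<lambda>_. lborel))
      \<partial>lborel)" for y :: "real \<times> (real, 'n) vec"
    have J: "J \<in> borel_measurable borel"
      "(\<integral>\<^sup>+y. J y \<partial>lborel) \<le> (\<integral>\<^sup>+x. ennreal (F x) \<partial>lborel) ^ (CARD('n) + 1)"
      using nn_integral_det_average_le[of ?P F, OF multi_power_measurable F F0]
      unfolding J_def[abs_def] by auto
    have "(\<integral>\<^sup>+y. (\<integral>\<^sup>+t. ennreal (G (averaging_point \<alpha> y t)) \<partial>lborel) ^ (CARD('n) + 1 + \<sigma>) \<partial>lborel)
      \<le> (\<integral>\<^sup>+y. ennreal C * J y \<partial>lborel)"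
    proof (rule nn_integral_mono)
      fix y :: "real \<times> (real, 'n) vec"
      show "(\<integral>\<^sup>+t. ennreal (G (averaging_point \<alpha> y t)) \<partial>lborel) ^ (CARD('n) + 1 + \<sigma>) \<le> ennreal C * J y"
        using det_ineq[of "\<lambda>t. G (averaging_point \<alpha> y t)"] G0
        unfolding J_def F_def by (simp add: averaging_point_def del: power_Suc)
    qed
    also have "\<dots> = ennreal C * (\<integral>\<^sup>+y. J y \<partial>lborel)"
      by (rule nn_integral_cmult) (use J in simp)
    also have "\<dots> \<le> ennreal C * (\<integral>\<^sup>+x. ennreal (F x) \<partial>lborel) ^ (CARD('n) + 1)"
      by (intro mult_left_mono J) simp
    finally show "(\<integral>\<^sup>+y. (\<integral>\<^sup>+t. ennreal (G (averaging_point \<alpha> y t)) \<partial>lborel) ^ (CARD('n) + 1 + \<sigma>) \<partial>lborel)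
      \<le> ennreal C * (\<integral>\<^sup>+x. ennreal (G x powr p) \<partial>lborel) ^ (CARD('n) + 1)"
      unfolding F_def .
  qed
  then show ?thesis using C by blast
qed

text \<open>The change of variables theorem of the library is restricted to index types of class
  \<open>wellorder\<close>; a copy of the given index type carries such an order.\<close>

typedef 'a ordered_copy = "UNIV :: 'a set"
  morphisms of_copy to_copy ..

lemma bij_to_copy: "bij to_copy"
  by (rule bij_betw_byWitness[where f' = of_copy]) (simp_all add: of_copy_inverse to_copy_inverse)

instance ordered_copy :: (finite) finite
proof
  have "finite (to_copy ` (UNIV :: 'a set))"
    by (intro finite_imageI finite)
  then show "finite (UNIV :: 'a ordered_copy set)"
    by (simp only: bij_is_surj[OF bij_to_copy])
qed

text \<open>The numbering is arbitrary, since the bound holds for every order of the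
  monomials.\<close>

definition copy_index :: "'a::finite ordered_copy \<Rightarrow> nat" where
  "copy_index = (SOME f. inj f)"

lemma inj_copy_index: "inj copy_index"
proof -
  obtain f :: "'a ordered_copy \<Rightarrow> nat" where "inj f"
    using finite_imp_inj_to_nat_seg[OF finite] by blast
  then show ?thesis
    unfolding copy_index_def by (rule someI[of inj])
qed

instantiation ordered_copy :: (finite) wellorder
begin

definition less_eq_ordered_copy :: "'a ordered_copy \<Rightarrow> 'a ordered_copy \<Rightarrow> bool" where
  "x \<le> y \<longleftrightarrow> copy_index x \<le> copy_index y"

definition less_ordered_copy :: "'a ordered_copy \<Rightarrow> 'a ordered_copy \<Rightarrow> bool" where
  "x < y \<longleftrightarrow> copy_index x < copy_index y"

instance
proof
  fix x y z :: "'a ordered_copy"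
  show "x < y \<longleftrightarrow> x \<le> y \<and> \<not> y \<le> x" "x \<le> x" "x \<le> y \<or> y \<le> x"
    by (auto simp: less_eq_ordered_copy_def less_ordered_copy_def)
  show "x \<le> z" if "x \<le> y" "y \<le> z"
    using that by (simp add: less_eq_ordered_copy_def)
  show "x = y" if "x \<le> y" "y \<le> x"
    using that by (intro injD[OF inj_copy_index]) (simp add: less_eq_ordered_copy_def)
next
  fix P :: "'a ordered_copy \<Rightarrow> bool" and a
  assume step: "\<And>x. (\<And>y. y < x \<Longrightarrow> P y) \<Longrightarrow> P x"
  show "P a"
  proof (induction a rule: measure_induct_rule[of copy_index])
    case (less x)
    show ?case
      by (rule step, rule less) (simp only: less_ordered_copy_def)
  qed
qed

end

text \<open>Monomials and coordinates are both relabelled by \<open>of_copy\<close>. The map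
  \<open>R\<close> preserves Lebesgue measure and carries the averages of \<open>G\<close> to those
  of \<open>H\<close>, so the bound for \<open>\<beta>\<close> transfers with the same
  constant.\<close>

lemma averaging_bound_finite:
  fixes \<alpha> :: "'n::finite \<Rightarrow> nat ^ 'n"
  assumes det: "det (exponent_matrix \<alpha>) \<noteq> 0"
    and sum: "\<And>i. (\<Sum>k\<in>UNIV. \<alpha> k $ i) = \<sigma>" and \<sigma>: "0 < \<sigma>"
    and p: "p = (real CARD('n) + 1 + real \<sigma>) / (real CARD('n) + 1)"
  shows "\<exists>C\<ge>0. averaging_bound \<alpha> \<sigma> p C"
proof -
  define \<beta> :: "'n ordered_copy \<Rightarrow> (nat, 'n ordered_copy) vec"
    where "\<beta> k = (\<chi> i. \<alpha> (of_copy k) $ of_copy i)" for k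
  define R :: "(real, 'n ordered_copy) vec \<Rightarrow> real ^ 'n" where "R = (\<lambda>t. \<chi> i. t $ to_copy i)"
  have R_nth: "R t $ of_copy k = t $ k" for t k
    by (simp add: R_def of_copy_inverse)
  have bij: "bij (of_copy :: 'n ordered_copy \<Rightarrow> 'n)"
    by (rule bij_betw_byWitness[where f' = to_copy]) (simp_all add: of_copy_inverse to_copy_inverse)
  have card: "CARD('n ordered_copy) = CARD('n)"
    by (rule bij_betw_same_card[OF bij])
  have R_meas [measurable]: "R \<in> borel_measurable borel"
    unfolding R_def[abs_def] by (intro borel_measurable_continuous_onI continuous_intros)
  have R: "(\<integral>\<^sup>+t. f t \<partial>lborel) = (\<integral>\<^sup>+t. f (R t) \<partial>lborel)" if "f \<in> borel_measurable borel" for f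
    unfolding R_def by (rule nn_integral_vec_reindex[OF bij_to_copy that])
  have power: "multi_power (R t) (\<alpha> (of_copy k)) = multi_power t (\<beta> k)" for t k
    unfolding multi_power_def
    by (subst prod.reindex_bij_betw[OF bij, symmetric]) (simp add: R_nth \<beta>_def)
  have "det (exponent_matrix \<beta>) \<noteq> 0"
  proof -
    have "u = 0" if "exponent_matrix \<beta> *v u = 0" for u
    proof -
      have "(exponent_matrix \<alpha> *v R u) $ of_copy k = (exponent_matrix \<beta> *v u) $ k" for k
        unfolding matrix_vector_mult_def exponent_matrix_def multiindex_vec_def \<beta>_def
        by simp (subst sum.reindex_bij_betw[OF bij, symmetric], simp add: R_nth)
      then have "(exponent_matrix \<alpha> *v R u) $ of_copy (to_copy i) = 0" for i
        using that by simp
      then have "exponent_matrix \<alpha> *v R u = 0"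
        by (simp add: vec_eq_iff to_copy_inverse)
      then have "R u = 0"
        using det by (metis invertible_det_nz invertible_def matrix_left_invertible_ker)
      then show "u = 0"
        by (metis R_nth vec_eq_iff zero_index)
    qed
    then show ?thesis
      by (metis invertible_det_nz invertible_left_inverse matrix_left_invertible_ker)
  qed
  moreover have "(\<Sum>k\<in>UNIV. \<beta> k $ i) = \<sigma>" for i
    using sum[of "of_copy i"] unfolding \<beta>_def
    by (subst (asm) sum.reindex_bij_betw[OF bij, symmetric]) simp
  ultimately obtain C where C: "C \<ge> 0" "averaging_bound \<beta> \<sigma> p C"
    using averaging_bound_wellorder[of \<beta> \<sigma> p] \<sigma> p unfolding card by blast
  have "averaging_bound \<alpha> \<sigma> p C"
    unfolding averaging_bound_def
  proof (intro ballI impI)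
    fix G :: "(real ^ 'n) \<times> real \<Rightarrow> real"
    assume G [measurable]: "G \<in> borel_measurable borel" and G0: "\<forall>x. 0 \<le> G x"
    have G' [measurable]: "G \<in> borel_measurable (borel \<Otimes>\<^sub>M borel)"
      using G by (simp add: borel_prod)
    define H where "H x = G (R (fst x), snd x)" for x
    have H [measurable]: "H \<in> borel_measurable borel"
      unfolding H_def borel_prod[symmetric] by measurable
    have point: "G (averaging_point \<alpha> (y, R v) (R t)) = H (averaging_point \<beta> (y, v) t)" for y v t
      unfolding averaging_point_def H_def
      by (subst sum.reindex_bij_betw[OF bij, symmetric]) (simp add: R_nth power)
    let ?A = "\<lambda>y. \<integral>\<^sup>+t. ennreal (G (averaging_point \<alpha> y t)) \<partial>lborel"
    let ?q = "CARD('n) + 1 + \<sigma>"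
    have A_meas: "(\<lambda>y. ?A y ^ ?q) \<in> borel_measurable borel"
      by measurable
    have [measurable]: "(\<lambda>v. ?A (y\<^sub>0, v) ^ ?q) \<in> borel_measurable borel" for y\<^sub>0
      by (rule measurable_compose[OF _ A_meas]) (simp add: borel_prod[symmetric])
    \<comment> \<open>\<open>R\<close> acts only on the vector component of \<open>y\<close>, so
      \<open>y\<^sub>0\<close> is split off before relabelling.\<close>
    have "(\<integral>\<^sup>+y. ?A y ^ ?q \<partial>lborel) = (\<integral>\<^sup>+y\<^sub>0. \<integral>\<^sup>+v. ?A (y\<^sub>0, v) ^ ?q \<partial>lborel \<partial>lborel)"
      unfolding lborel_prod[symmetric] by (rule lborel.nn_integral_fst[symmetric]) (use A_meas in \<open>simp only: lborel_prod measurable_lborel2\<close>)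
    also have "\<dots> = (\<integral>\<^sup>+y\<^sub>0. \<integral>\<^sup>+v. ?A (y\<^sub>0, R v) ^ ?q \<partial>lborel \<partial>lborel)"
      by (intro nn_integral_cong R) measurable
    also have "\<dots> = (\<integral>\<^sup>+y\<^sub>0. \<integral>\<^sup>+v. (\<integral>\<^sup>+t. ennreal (H (averaging_point \<beta> (y\<^sub>0, v) t)) \<partial>lborel) ^ ?q \<partial>lborel \<partial>lborel)"
      by (subst R) (simp_all add: point)
    also have "\<dots> = (\<integral>\<^sup>+y. (\<integral>\<^sup>+t. ennreal (H (averaging_point \<beta> y t)) \<partial>lborel) ^ ?q \<partial>lborel)"
      unfolding lborel_prod[symmetric]
    proof (rule lborel.nn_integral_fst)
      show "(\<lambda>y. (\<integral>\<^sup>+t. ennreal (H (averaging_point \<beta> y t)) \<partial>lborel) ^ ?q) \<in> borel_measurable (lborel \<Otimes>\<^sub>M lborel)"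
        unfolding lborel_prod by measurable
    qed
    also have "\<dots> \<le> ennreal C * (\<integral>\<^sup>+x. ennreal (H x powr p) \<partial>lborel) ^ (CARD('n) + 1)"
    proof -
      have "\<forall>x. 0 \<le> H x" using G0 by (simp add: H_def)
      then show ?thesis
        using C(2) H unfolding averaging_bound_def card by blast
    qed
    also have "(\<integral>\<^sup>+x. ennreal (H x powr p) \<partial>lborel) = (\<integral>\<^sup>+t. \<integral>\<^sup>+s. ennreal (G (R t, s) powr p) \<partial>lborel \<partial>lborel)"
      unfolding lborel_prod[symmetric] by (subst lborel.nn_integral_fst[symmetric]) (simp_all add: H_def)
    also have "\<dots> = (\<integral>\<^sup>+t. \<integral>\<^sup>+s. ennreal (G (t, s) powr p) \<partial>lborel \<partial>lborel)"
      by (rule R[symmetric]) measurable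
    also have "\<dots> = (\<integral>\<^sup>+x. ennreal (G x powr p) \<partial>lborel)"
      unfolding lborel_prod[symmetric] by (rule lborel.nn_integral_fst) simp
    finally show "(\<integral>\<^sup>+y. ?A y ^ ?q \<partial>lborel) \<le> ennreal C * (\<integral>\<^sup>+x. ennreal (G x powr p) \<partial>lborel) ^ (CARD('n) + 1)" .
  qed
  then show ?thesis using C by blast
qed

section \<open>From Borel to Lebesgue measurable functions\<close>

text \<open>Independence of a range concerns a set of vectors; injectivity turns it into
  independence of the family of rows.\<close>

lemma det_exponent_matrix_nonzero:
  fixes \<alpha> :: "'n::finite \<Rightarrow> nat ^ 'n"
  assumes inj: "inj (\<lambda>j. multiindex_vec (\<alpha> j))"
    and indep: "independent (range (\<lambda>j. multiindex_vec (\<alpha> j)))"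
  shows "det (exponent_matrix \<alpha>) \<noteq> 0"
proof -
  let ?v = "\<lambda>j. multiindex_vec (\<alpha> j)"
  have "c i = 0" if c: "(\<Sum>i\<in>UNIV. c i *s row i (exponent_matrix \<alpha>)) = 0" for c i
  proof -
    have row: "row i (exponent_matrix \<alpha>) = ?v i" for i
      by (simp add: row_def exponent_matrix_def vec_eq_iff)
    have "(\<Sum>w\<in>range ?v. c (inv ?v w) *\<^sub>R w) = (\<Sum>i\<in>UNIV. c i *\<^sub>R ?v i)"
      by (simp add: sum.reindex[OF inj] inv_f_f[OF inj])
    also have "\<dots> = 0"
      using c by (simp add: row scalar_mult_eq_scaleR)
    finally have "c (inv ?v (?v i)) = 0"
      by (intro independentD[OF indep]) auto
    then show ?thesis
      by (simp only: inv_f_f[OF inj])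
  qed
  then show ?thesis
    by (metis invertible_det_nz invertible_right_inverse matrix_right_invertible_independent_rows)
qed

lemma lebesgue_measurable_complex_eq_borel:
  fixes f :: "'a::euclidean_space \<Rightarrow> complex"
  assumes "f \<in> borel_measurable lebesgue"
  obtains g where "g \<in> borel_measurable borel" "AE x in lborel. f x = g x"
proof -
  have "(\<lambda>x. Re (f x)) \<in> borel_measurable lebesgue" "(\<lambda>x. Im (f x)) \<in> borel_measurable lebesgue"
    using assms by measurable
  from this[THEN completion_ex_borel_measurable_real]
  obtain u v where [measurable]: "u \<in> borel_measurable lborel" "v \<in> borel_measurable lborel"
    and uv: "AE x in lborel. Re (f x) = u x" "AE x in lborel. Im (f x) = v x"
    by blast
  show thesis
  proof (rule that)
    show "(\<lambda>x. of_real (u x) + \<i> * of_real (v x)) \<in> borel_measurable borel"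
      by measurable
    show "AE x in lborel. f x = of_real (u x) + \<i> * of_real (v x)"
      using uv by eventually_elim (simp add: complex_eq_iff)
  qed
qed

text \<open>Each hypersurface is itself a null set, so it is not evident that averages ignore
  changes of \<open>f\<close> on null sets. The bound for the indicator of a Borel null set has
  right-hand side 0, so almost every hypersurface meets that set only for a null set of
  \<open>t\<close>.\<close>

lemma averaging_bound_imp_AE:
  fixes \<alpha> :: "'n::finite \<Rightarrow> nat ^ 'n"
  assumes bound: "averaging_bound \<alpha> \<sigma> p C" and ae: "AE x in lborel. P x"
  shows "AE y in lborel. AE t in lborel. P (averaging_point \<alpha> y t)"
proof -
  obtain N where "{x \<in> space lborel. \<not> P x} \<subseteq> N" "emeasure lborel N = 0" "N \<in> sets lborel"
    using AE_E[OF ae] by blast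
  then have N: "{x. \<not> P x} \<subseteq> N" "N \<in> null_sets lborel"
    by (auto simp: null_sets_def)
  define G :: "(real ^ 'n) \<times> real \<Rightarrow> real" where "G = indicator N"
  have [measurable]: "N \<in> sets borel"
    using N(2) by auto
  have [measurable]: "G \<in> borel_measurable borel"
    unfolding G_def by measurable
  let ?q = "CARD('n) + 1 + \<sigma>"
  let ?A = "\<lambda>y. \<integral>\<^sup>+t. ennreal (G (averaging_point \<alpha> y t)) \<partial>lborel"
  have "AE x in lborel. x \<notin> N"
    by (rule AE_not_in[OF N(2)])
  then have "(\<integral>\<^sup>+x. ennreal (G x powr p) \<partial>lborel) = 0"
    by (subst nn_integral_0_iff_AE) (auto simp: G_def)
  moreover have G0: "0 \<le> G x" for x by (simp add: G_def)
  ultimately have "(\<integral>\<^sup>+y. ?A y ^ ?q \<partial>lborel) \<le> 0"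
    using bound[unfolded averaging_bound_def, rule_format, of G, OF _ G0] by simp
  then have "AE y in lborel. ?A y ^ ?q = 0"
    by (subst (asm) le_zero_eq, subst (asm) nn_integral_0_iff_AE) auto
  then have "AE y in lborel. ?A y = 0"
    by eventually_elim auto
  then show ?thesis
  proof eventually_elim
    case (elim y)
    then have "AE t in lborel. ennreal (G (averaging_point \<alpha> y t)) = 0"
      by (subst (asm) nn_integral_0_iff_AE) auto
    then show ?case
      by eventually_elim (use N(1) in \<open>auto simp: G_def indicator_def split: if_splits\<close>)
  qed
qed

text \<open>\<open>f\<close> is replaced by a Borel function \<open>g\<close> equal to it almost
  everywhere, which leaves almost every average unchanged. The bound for \<open>norm g\<close> gives
  absolute convergence, and its \<open>q\<close>-th root gives the norm estimate.\<close>

lemma averaging_bound_imp_Lp_bounded: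
  fixes \<alpha> :: "'n::finite \<Rightarrow> nat ^ 'n"
  assumes bound: "averaging_bound \<alpha> \<sigma> p C" and C: "0 \<le> C"
    and p: "p = (real CARD('n) + 1 + real \<sigma>) / (real CARD('n) + 1)"
    and q: "q = real CARD('n) + 1 + real \<sigma>"
    and f: "f \<in> Lp_space p lebesgue"
  shows "AE y in lebesgue. integrable lebesgue (\<lambda>t. f (averaging_point \<alpha> y t))"
    and "averaging_op \<alpha> f \<in> Lp_space q lebesgue"
    and "Lp_norm q lebesgue (averaging_op \<alpha> f) \<le> C powr (1 / q) * Lp_norm p lebesgue f"
proof -
  let ?N = "CARD('n) + 1 + \<sigma>"
  have q0: "q > 0" and qN: "q = real ?N" and pq: "1 / p = (real CARD('n) + 1) / q"
    unfolding p q by auto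
  have f_meas: "f \<in> borel_measurable lebesgue" and f_int: "integrable lebesgue (\<lambda>x. norm (f x) powr p)"
    using f by (auto simp: Lp_space_def)
  obtain g where g [measurable]: "g \<in> borel_measurable borel" and fg: "AE x in lborel. f x = g x"
    by (rule lebesgue_measurable_complex_eq_borel[OF f_meas])
  define I where "I = (\<integral>x. norm (f x) powr p \<partial>lebesgue)"
  have I0: "I \<ge> 0" unfolding I_def by simp
  have "ennreal I = (\<integral>\<^sup>+x. ennreal (norm (f x) powr p) \<partial>lebesgue)"
    unfolding I_def by (rule nn_integral_eq_integral[symmetric]) (use f_int in auto)
  also have "\<dots> = (\<integral>\<^sup>+x. ennreal (norm (f x) powr p) \<partial>lborel)"
    by (rule nn_integral_completion)
  also have "\<dots> = (\<integral>\<^sup>+x. ennreal (norm (g x) powr p) \<partial>lborel)"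
    by (rule nn_integral_cong_AE) (use fg in \<open>eventually_elim, simp\<close>)
  finally have I: "(\<integral>\<^sup>+x. ennreal (norm (g x) powr p) \<partial>lborel) = ennreal I" ..
  define B where "B y = (\<integral>\<^sup>+t. ennreal (norm (g (averaging_point \<alpha> y t))) \<partial>lborel)" for y
  have [measurable]: "B \<in> borel_measurable borel"
    unfolding B_def by (rule measurable_nn_integral_averaging_point[of "\<lambda>x. norm (g x)"]) measurable
  define K where "K = C * I ^ (CARD('n) + 1)"
  have K0: "K \<ge> 0" using C I0 by (simp add: K_def)
  have "(\<integral>\<^sup>+y. B y ^ ?N \<partial>lborel) \<le> ennreal C * ennreal I ^ (CARD('n) + 1)"
    using bound[unfolded averaging_bound_def, rule_format, of "\<lambda>x. norm (g x)"] unfolding B_def I by simp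
  also have "\<dots> = ennreal K"
    unfolding K_def using C I0 by (simp only: ennreal_power ennreal_mult zero_le_power)
  finally have BK: "(\<integral>\<^sup>+y. B y ^ ?N \<partial>lborel) \<le> ennreal K" .
  have "AE y in lborel. B y ^ ?N \<noteq> \<infinity>"
    by (rule nn_integral_PInf_AE) (use BK in \<open>auto simp: top_unique\<close>)
  \<comment> \<open>Finiteness of these averages makes the integrals of \<open>g\<close> genuine
    rather than the default value 0.\<close>
  then have B_fin: "AE y in lborel. B y < \<infinity>"
  proof eventually_elim
    case (elim y)
    then have "B y \<noteq> top"
      using power_eq_top_ennreal[of "B y" ?N] by auto
    then show ?case
      by (simp add: less_top)
  qed
  have good: "AE y in lborel. integrable lborel (\<lambda>t. g (averaging_point \<alpha> y t))
    \<and> (AE t in lborel. f (averaging_point \<alpha> y t) = g (averaging_point \<alpha> y t))"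
    using B_fin averaging_bound_imp_AE[OF bound fg]
  proof eventually_elim
    case (elim y)
    have "integrable lborel (\<lambda>t. g (averaging_point \<alpha> y t))"
      by (rule integrableI_bounded) (use elim(1) in \<open>simp_all add: B_def\<close>)
    then show ?case
      using elim(2) ..
  qed
  \<comment> \<open>\<open>T\<close> is a Borel version of \<open>averaging_op \<alpha> f\<close>;
    completeness of Lebesgue measure transfers its measurability.\<close>
  define T where "T y = (\<integral>t. g (averaging_point \<alpha> y t) \<partial>lborel)" for y
  have [measurable]: "T \<in> borel_measurable borel"
    unfolding T_def by measurable
  have good': "AE y in lborel. integrable lebesgue (\<lambda>t. f (averaging_point \<alpha> y t))
    \<and> T y = averaging_op \<alpha> f y \<and> ennreal (norm (T y)) \<le> B y"
    using good
  proof eventually_elim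
    case (elim y)
    have int: "integrable lborel (\<lambda>t. g (averaging_point \<alpha> y t))" using elim by blast
    have eq: "AE t in lebesgue. g (averaging_point \<alpha> y t) = f (averaging_point \<alpha> y t)"
      using elim by (intro AE_completion) (auto elim!: eventually_mono)
    have gm: "(\<lambda>t. g (averaging_point \<alpha> y t)) \<in> borel_measurable lborel" by measurable
    then have gm': "(\<lambda>t. g (averaging_point \<alpha> y t)) \<in> borel_measurable lebesgue"
      by (rule measurable_completion)
    have fm: "(\<lambda>t. f (averaging_point \<alpha> y t)) \<in> borel_measurable lebesgue"
      by (rule borel_measurable_AE[OF gm' eq])
    have "integrable lebesgue (\<lambda>t. g (averaging_point \<alpha> y t))"
      using int gm by (simp add: integrable_completion)
    then have "integrable lebesgue (\<lambda>t. f (averaging_point \<alpha> y t))"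
      using integrable_cong_AE[OF gm' fm eq] by simp
    moreover have "T y = averaging_op \<alpha> f y"
      unfolding T_def averaging_op_def integral_completion[OF gm, symmetric]
      by (rule integral_cong_AE[OF gm' fm eq])
    moreover have "ennreal (norm (T y)) \<le> B y"
      unfolding T_def B_def by (rule integral_norm_bound_ennreal[OF int])
    ultimately show ?case by blast
  qed
  then show "AE y in lebesgue. integrable lebesgue (\<lambda>t. f (averaging_point \<alpha> y t))"
    by (intro AE_completion) (auto elim!: eventually_mono)
  have T_eq: "AE y in lebesgue. T y = averaging_op \<alpha> f y"
    using good' by (intro AE_completion) (auto elim!: eventually_mono)
  have Rf_meas [measurable]: "averaging_op \<alpha> f \<in> borel_measurable lebesgue"
    by (rule borel_measurable_AE[OF _ T_eq]) (simp add: measurable_completion)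
  have "(\<integral>\<^sup>+y. ennreal (norm (averaging_op \<alpha> f y) powr q) \<partial>lebesgue)
    = (\<integral>\<^sup>+y. ennreal (norm (averaging_op \<alpha> f y) powr q) \<partial>lborel)"
    by (rule nn_integral_completion)
  also have "\<dots> \<le> (\<integral>\<^sup>+y. B y ^ ?N \<partial>lborel)"
  proof (rule nn_integral_mono_AE)
    show "AE y in lborel. ennreal (norm (averaging_op \<alpha> f y) powr q) \<le> B y ^ ?N"
      using good'
    proof eventually_elim
      case (elim y)
      have "norm (averaging_op \<alpha> f y) powr q = norm (T y) ^ ?N"
        using elim unfolding qN by (subst powr_realpow') auto
      also have "ennreal \<dots> = ennreal (norm (T y)) ^ ?N"
        by (rule ennreal_power[symmetric]) simp
      also have "\<dots> \<le> B y ^ ?N"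
        using elim by (intro power_mono) auto
      finally show ?case .
    qed
  qed
  also note BK
  finally have le: "(\<integral>\<^sup>+y. ennreal (norm (averaging_op \<alpha> f y) powr q) \<partial>lebesgue) \<le> ennreal K" .
  have Rf_int: "integrable lebesgue (\<lambda>y. norm (averaging_op \<alpha> f y) powr q)"
  proof (rule integrableI_bounded)
    show "(\<integral>\<^sup>+y. ennreal (norm (norm (averaging_op \<alpha> f y) powr q)) \<partial>lebesgue) < \<infinity>"
      using le by (simp add: le_less_trans)
  qed measurable
  then show "averaging_op \<alpha> f \<in> Lp_space q lebesgue"
    by (simp add: Lp_space_def Rf_meas)
  have "ennreal (\<integral>y. norm (averaging_op \<alpha> f y) powr q \<partial>lebesgue) \<le> ennreal K"
    using le nn_integral_eq_integral[OF Rf_int] by simp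
  then have "(\<integral>y. norm (averaging_op \<alpha> f y) powr q \<partial>lebesgue) \<le> K"
    using K0 by simp
  then have "Lp_norm q lebesgue (averaging_op \<alpha> f) \<le> K powr (1 / q)"
    unfolding Lp_norm_def using q0 by (intro powr_mono2) auto
  also have "\<dots> = C powr (1 / q) * (I ^ (CARD('n) + 1)) powr (1 / q)"
    unfolding K_def using C I0 by (simp add: powr_mult del: power_Suc)
  \<comment> \<open>The power of \<open>I\<close> matches because
    \<open>1 / p = (CARD('n) + 1) / q\<close>.\<close>
  also have "(I ^ (CARD('n) + 1)) powr (1 / q) = I powr (1 / p)"
  proof -
    have "I ^ (CARD('n) + 1) = I powr (real CARD('n) + 1)"
      using I0 powr_realpow'[of I "CARD('n) + 1"] by (simp add: add_ac)
    then show ?thesis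
      by (simp add: powr_powr pq)
  qed
  finally show "Lp_norm q lebesgue (averaging_op \<alpha> f) \<le> C powr (1 / q) * Lp_norm p lebesgue f"
    unfolding Lp_norm_def I_def .
qed

theorem corollary2:
  fixes \<alpha> :: "'n::finite \<Rightarrow> nat ^ 'n" and \<sigma> :: int and p q :: real
  assumes "inj (\<lambda>j. multiindex_vec (\<alpha> j))"
    and "independent (range (\<lambda>j. multiindex_vec (\<alpha> j)))"
    and "(\<Sum>j\<in>UNIV. multiindex_vec (\<alpha> j)) = (\<chi> i. of_int \<sigma>)"
    and "p = (real CARD('n) + 1 + of_int \<sigma>) / (real CARD('n) + 1)"
    and "q = real CARD('n) + 1 + of_int \<sigma>"
  shows "(\<forall>f\<in>Lp_space p lebesgue. AE y in lebesgue.
            integrable lebesgue (\<lambda>t. f (averaging_point \<alpha> y t)))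
         \<and> Lp_bounded p lebesgue q lebesgue (averaging_op \<alpha>)"
proof -
  \<comment> \<open>The conversion is faithful, as \<open>\<sigma>\<close> is a sum of natural
    exponents.\<close>
  define s where "s = nat \<sigma>"
  have det: "det (exponent_matrix \<alpha>) \<noteq> 0"
    by (rule det_exponent_matrix_nonzero) fact+
  have sum_int: "int (\<Sum>k\<in>UNIV. \<alpha> k $ i) = \<sigma>" for i
  proof -
    have "real (\<Sum>k\<in>UNIV. \<alpha> k $ i) = (\<Sum>j\<in>UNIV. multiindex_vec (\<alpha> j)) $ i"
      by (simp add: multiindex_vec_def)
    also have "\<dots> = of_int \<sigma>"
      unfolding assms(3) by simp
    finally show ?thesis
      by (metis of_int_eq_iff of_int_of_nat_eq)
  qed
  have sum: "(\<Sum>k\<in>UNIV. \<alpha> k $ i) = s" for i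
    using sum_int[of i] unfolding s_def by (metis nat_int)
  have \<sigma>: "of_int \<sigma> = real s"
    using sum_int sum by (metis of_int_of_nat_eq)
  \<comment> \<open>For \<open>s = 0\<close> all exponents vanish and the independent set contains
    the zero vector. Positivity matters because \<open>1 / \<sigma>\<close> occurs in the kernel
    exponents.\<close>
  have "s > 0"
  proof (rule ccontr)
    assume "\<not> s > 0"
    then have "\<alpha> k $ i = 0" for k i
      using sum[of i] by simp
    then have "multiindex_vec (\<alpha> k) = 0" for k
      by (simp add: multiindex_vec_def vec_eq_iff)
    then have "0 \<in> range (\<lambda>j. multiindex_vec (\<alpha> j))"
      by (metis rangeI)
    then have "dependent (range (\<lambda>j. multiindex_vec (\<alpha> j)))"
      by (rule dependent_zero)
    then show False
      using assms(2) by contradiction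
  qed
  then obtain C where C: "C \<ge> 0" "averaging_bound \<alpha> s p C"
    using averaging_bound_finite[OF det sum] assms(4) unfolding \<sigma> by blast
  note bounded = averaging_bound_imp_Lp_bounded[OF C(2,1) assms(4)[unfolded \<sigma>] assms(5)[unfolded \<sigma>]]
  show ?thesis
    unfolding Lp_bounded_def by (intro conjI ballI exI[of _ "C powr (1 / q)"] bounded)
qed

end
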